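(* Suppose $(A,B)$ is controllable and $(Q^{1/2},A)$ is observable. Consider the state feedback $\mathcal{H}_\infty$ policy optimization problem $\inf_{K\in\mathcal{K}}J_\infty(K)$, $J_\infty(K)=\|\mathbf{T}_{zw}(K,s)\|_{\mathcal{H}_\infty}$, where $B_w$ has full row rank and $Q\succ0$, $R\succ0$. The following statements hold. (1) One has $K\in\mathcal{K}$ and $\gamma\ge J_\infty(K)$ if and only if there exists $P$ such that $(K,\gamma,P)\in\mathcal{L}_\infty$. This further implies $\pi_{K,\gamma}(\mathcal{L}_\infty)=\operatorname{epi}_\ge(J_\infty)$. (2) The mapping $\Phi_\infty(K,\gamma,P)=(\gamma,KP^{-1},P^{-1})$ is a $C^2$ (and in fact $C^\infty$) diffeomorphism between the lifted set $\mathcal{L}_\infty$ and the convex set $\mathcal{F}_\infty$.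
   Context: Setting: $A\in\mathbb{R}^{n\times n}$, $B\in\mathbb{R}^{n\times m}$, $B_w\in\mathbb{R}^{n\times n}$, $Q\in\mathbb{S}^n$, $R\in\mathbb{S}^m$. $\mathcal{K}=\{K\in\mathbb{R}^{m\times n}\mid\max_i\operatorname{Re}\lambda_i(A+BK)<0\}$. $\mathbf{T}_{zw}(K,s)=\begin{bmatrix}Q^{1/2}\\ R^{1/2}K\end{bmatrix}(sI-A-BK)^{-1}B_w$, and $\|\mathbf{T}\|_{\mathcal{H}_\infty}=\sup_{\omega\in\mathbb{R}}\sigma_{\max}(\mathbf{T}(j\omega))$. $\operatorname{epi}_\ge(J_\infty)=\{(K,\gamma)\in\mathcal{K}\times\mathbb{R}\mid\gamma\ge J_\infty(K)\}$. The lifted set is $$\mathcal{L}_\infty=\left\{(K,\gamma,P)\ \middle|\ P\succ0,\ \begin{bmatrix}(A+BK)^{\mathsf T}P+P(A+BK)&PB_w&Q^{1/2}&K^{\mathsf T}R^{1/2}\\ B_w^{\mathsf T}P&-\gamma I&0&0\\ Q^{1/2}&0&-\gamma I&0\\ R^{1/2}K&0&0&-\gamma I\end{bmatrix}\preceq0\right\}$$ with $K\in\mathbb{R}^{m\times n},\gamma\in\mathbb{R},P\in\mathbb{S}^n$; $\pi_{K,\gamma}(\mathcal{L}_\infty)=\{(K,\gamma):\exists P,\ (K,\gamma,P)\in\mathcal{L}_\infty\}$. The convex set is $$\mathcal{F}_\infty=\left\{(\gamma,Y,X)\ \middle|\ X\succ0,\ Y\in\mathbb{R}^{m\times n},\ \begin{bmatrix}AX+BY+XA^{\mathsf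 T}+Y^{\mathsf T}B^{\mathsf T}&B_w&XQ^{1/2}&Y^{\mathsf T}R^{1/2}\\ B_w^{\mathsf T}&-\gamma I&0&0\\ Q^{1/2}X&0&-\gamma I&0\\ R^{1/2}Y&0&0&-\gamma I\end{bmatrix}\preceq0\right\}.$$ A $C^2$ (resp. $C^\infty$) diffeomorphism between two subsets of Euclidean spaces means a bijection that extends to a $C^2$ (resp. $C^\infty$) function on an open set containing the first subset, the extension being a bijection onto its image with $C^2$ (resp. $C^\infty$) inverse. *)

theory Defs
  imports "HOL-Analysis.Analysis" "HOL-Library.Extended_Nat"
begin

text \<open>A \<^typ>\<open>'a ^ 'q ^ 'p\<close> has rows indexed by \<^typ>\<open>'p\<close> and columns indexed by \<^typ>\<open>'q\<close>.
  Block matrices are indexed by sum types; the operators below put two blocks next to each other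
  and on top of each other, respectively.\<close>

definition hcat :: "'a ^ 'q ^ 'p \<Rightarrow> 'a ^ 'r ^ 'p \<Rightarrow> 'a ^ ('q + 'r) ^ 'p"  (infixr \<open>|||\<close> 60)
  where "M ||| N = (\<chi> i j. case j of Inl k \<Rightarrow> M $ i $ k | Inr k \<Rightarrow> N $ i $ k)"

definition vcat :: "'a ^ 'q ^ 'p \<Rightarrow> 'a ^ 'q ^ 'r \<Rightarrow> 'a ^ 'q ^ ('p + 'r)"  (infixr \<open>'/'/'/\<close> 55)
  where "M /// N = (\<chi> i. case i of Inl k \<Rightarrow> M $ k | Inr k \<Rightarrow> N $ k)"

definition pos_semidef :: "real ^ 'n ^ 'n \<Rightarrow> bool"
  where "pos_semidef M \<longleftrightarrow> transpose M = M \<and> (\<forall>x. 0 \<le> x \<bullet> (M *v x))"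

definition pos_def :: "real ^ 'n ^ 'n \<Rightarrow> bool"
  where "pos_def M \<longleftrightarrow> transpose M = M \<and> (\<forall>x. x \<noteq> 0 \<longrightarrow> 0 < x \<bullet> (M *v x))"

definition neg_semidef :: "real ^ 'n ^ 'n \<Rightarrow> bool"
  where "neg_semidef M \<longleftrightarrow> transpose M = M \<and> (\<forall>x. x \<bullet> (M *v x) \<le> 0)"

text \<open>The principal square root, which exists and is unique for a positive semidefinite argument.\<close>

definition mat_sqrt :: "real ^ 'n ^ 'n \<Rightarrow> real ^ 'n ^ 'n"
  where "mat_sqrt M = (THE S. pos_semidef S \<and> S ** S = M)"

abbreviation cmat :: "real ^ 'q ^ 'p \<Rightarrow> complex ^ 'q ^ 'p"
  where "cmat \<equiv> map_matrix complex_of_real"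

definition eigenvalues :: "complex ^ 'n ^ 'n \<Rightarrow> complex set"
  where "eigenvalues M = {l. \<exists>v. v \<noteq> 0 \<and> M *v v = l *s v}"

definition singular_values :: "complex ^ 'q ^ 'p \<Rightarrow> real set"
  where "singular_values M =
    {\<sigma>. 0 \<le> \<sigma> \<and> complex_of_real (\<sigma>\<^sup>2) \<in> eigenvalues (transpose (map_matrix cnj M) ** M)}"

definition sigma_max :: "complex ^ 'q ^ 'p \<Rightarrow> real"
  where "sigma_max M = Max (singular_values M)"

text \<open>The Kalman rank conditions. The blocks \<open>A\<^sup>k B\<close> (resp. \<open>C A\<^sup>k\<close>) for \<open>k < n\<close> are not assembled
  into one matrix; instead, its column (resp. row) rank is taken directly as the dimension of
  the span of all columns (resp. rows). Note that \<open>^\<close> on \<^typ>\<open>real ^ 'n ^ 'n\<close> would be the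
  entrywise power.\<close>

definition controllable :: "real ^ 'n ^ 'n \<Rightarrow> real ^ 'm ^ 'n \<Rightarrow> bool"
  where "controllable A B \<longleftrightarrow>
    dim (\<Union>k<CARD('n). columns (((\<lambda>M. A ** M) ^^ k) B)) = CARD('n)"

definition observable :: "real ^ 'n ^ 'p \<Rightarrow> real ^ 'n ^ 'n \<Rightarrow> bool"
  where "observable C A \<longleftrightarrow>
    dim (\<Union>k<CARD('n). rows (((\<lambda>M. M ** A) ^^ k) C)) = CARD('n)"

definition stabilizing :: "real ^ 'n ^ 'n \<Rightarrow> real ^ 'm ^ 'n \<Rightarrow> (real ^ 'n ^ 'm) set"
  where "stabilizing A B = {K. Max (Re ` eigenvalues (cmat (A + B ** K))) < 0}"

definition Tzw :: "real ^ 'n ^ 'n \<Rightarrow> real ^ 'm ^ 'n \<Rightarrow> real ^ 'n ^ 'n \<Rightarrow> real ^ 'n ^ 'n \<Rightarrow> real ^ 'm ^ 'm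
    \<Rightarrow> real ^ 'n ^ 'm \<Rightarrow> complex \<Rightarrow> complex ^ 'n ^ ('n + 'm)"
  where "Tzw A B Bw Q R K s =
    cmat (mat_sqrt Q /// mat_sqrt R ** K) ** matrix_inv (mat s - cmat (A + B ** K)) ** cmat Bw"

text \<open>Extended-real valued, so that the supremum is meaningful without a boundedness assumption.\<close>

definition Hinf_norm :: "(complex \<Rightarrow> complex ^ 'q ^ 'p) \<Rightarrow> ereal"
  where "Hinf_norm T = (SUP \<omega>::real. ereal (sigma_max (T (\<i> * complex_of_real \<omega>))))"

definition J_inf :: "real ^ 'n ^ 'n \<Rightarrow> real ^ 'm ^ 'n \<Rightarrow> real ^ 'n ^ 'n \<Rightarrow> real ^ 'n ^ 'n
    \<Rightarrow> real ^ 'm ^ 'm \<Rightarrow> real ^ 'n ^ 'm \<Rightarrow> ereal"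
  where "J_inf A B Bw Q R K = Hinf_norm (Tzw A B Bw Q R K)"

definition epi_J_inf :: "real ^ 'n ^ 'n \<Rightarrow> real ^ 'm ^ 'n \<Rightarrow> real ^ 'n ^ 'n \<Rightarrow> real ^ 'n ^ 'n
    \<Rightarrow> real ^ 'm ^ 'm \<Rightarrow> ((real ^ 'n ^ 'm) \<times> real) set"
  where "epi_J_inf A B Bw Q R =
    {(K, \<gamma>). K \<in> stabilizing A B \<and> J_inf A B Bw Q R K \<le> ereal \<gamma>}"

definition L_inf :: "real ^ 'n ^ 'n \<Rightarrow> real ^ 'm ^ 'n \<Rightarrow> real ^ 'n ^ 'n \<Rightarrow> real ^ 'n ^ 'n
    \<Rightarrow> real ^ 'm ^ 'm \<Rightarrow> ((real ^ 'n ^ 'm) \<times> real \<times> (real ^ 'n ^ 'n)) set"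
  where "L_inf A B Bw Q R = {(K, \<gamma>, P). pos_def P \<and> neg_semidef (
      (transpose (A + B ** K) ** P + P ** (A + B ** K)
                        ||| P ** Bw      ||| mat_sqrt Q    ||| transpose K ** mat_sqrt R) ///
      (transpose Bw ** P ||| - \<gamma> *\<^sub>R mat 1 ||| 0             ||| 0) ///
      (mat_sqrt Q       ||| 0            ||| - \<gamma> *\<^sub>R mat 1 ||| 0) ///
      (mat_sqrt R ** K  ||| 0            ||| 0             ||| - \<gamma> *\<^sub>R mat 1))}"

definition F_inf :: "real ^ 'n ^ 'n \<Rightarrow> real ^ 'm ^ 'n \<Rightarrow> real ^ 'n ^ 'n \<Rightarrow> real ^ 'n ^ 'n
    \<Rightarrow> real ^ 'm ^ 'm \<Rightarrow> (real \<times> (real ^ 'n ^ 'm) \<times> (real ^ 'n ^ 'n)) set"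
  where "F_inf A B Bw Q R = {(\<gamma>, Y, X). pos_def X \<and> neg_semidef (
      (A ** X + B ** Y + X ** transpose A + transpose Y ** transpose B
                        ||| Bw           ||| X ** mat_sqrt Q ||| transpose Y ** mat_sqrt R) ///
      (transpose Bw     ||| - \<gamma> *\<^sub>R mat 1 ||| 0             ||| 0) ///
      (mat_sqrt Q ** X  ||| 0            ||| - \<gamma> *\<^sub>R mat 1 ||| 0) ///
      (mat_sqrt R ** Y  ||| 0            ||| 0             ||| - \<gamma> *\<^sub>R mat 1))}"

definition Phi_inf :: "(real ^ 'n ^ 'm) \<times> real \<times> (real ^ 'n ^ 'n) \<Rightarrow> real \<times> (real ^ 'n ^ 'm) \<times> (real ^ 'n ^ 'n)"
  where "Phi_inf = (\<lambda>(K, \<gamma>, P). (\<gamma>, K ** matrix_inv P, matrix_inv P))"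

definition proj_K_gamma :: "('k \<times> real \<times> 'p) set \<Rightarrow> ('k \<times> real) set"
  where "proj_K_gamma S = {(K, \<gamma>). \<exists>P. (K, \<gamma>, P) \<in> S}"

text \<open>Meant for open \<open>U\<close> in finite dimension, where continuity of \<open>x \<mapsto> D f(x)\<close> is the same as
  continuity of \<open>x \<mapsto> D f(x) h\<close> for every direction \<open>h\<close>.\<close>

primrec times_cont_diff_on ::
    "nat \<Rightarrow> 'a::euclidean_space set \<Rightarrow> ('a \<Rightarrow> 'b::euclidean_space) \<Rightarrow> bool"
  where
    "times_cont_diff_on 0 U f \<longleftrightarrow> continuous_on U f"
  | "times_cont_diff_on (Suc k) U f \<longleftrightarrow> (\<forall>x\<in>U. f differentiable (at x)) \<and>
       (\<forall>h. times_cont_diff_on k U (\<lambda>x. frechet_derivative f (at x) h))"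

definition C_on :: "enat \<Rightarrow> 'a::euclidean_space set \<Rightarrow> ('a \<Rightarrow> 'b::euclidean_space) \<Rightarrow> bool"
  where "C_on k U f \<longleftrightarrow> (\<forall>j. enat j \<le> k \<longrightarrow> times_cont_diff_on j U f)"

text \<open>The image of the extension is required to be open, so that being \<open>C\<^sup>k\<close> on it makes sense
  for the inverse.\<close>

definition C_diffeomorphism ::
    "enat \<Rightarrow> 'a::euclidean_space set \<Rightarrow> 'b::euclidean_space set \<Rightarrow> ('a \<Rightarrow> 'b) \<Rightarrow> bool"
  where "C_diffeomorphism k S T f \<longleftrightarrow> bij_betw f S T \<and>
    (\<exists>U g. open U \<and> S \<subseteq> U \<and> (\<forall>x\<in>S. g x = f x) \<and> C_on k U g \<and>
       inj_on g U \<and> open (g ` U) \<and> C_on k (g ` U) (the_inv_into U g))"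

end

theory Submission
  imports Defs "HOL-Computational_Algebra.Fundamental_Theorem_Algebra"
begin

text \<open>
  Write \<open>F = A + B K\<close> and \<open>G = Q + K\<^sup>T R K\<close>.  A Schur complement (\<open>arrow_form_nonpos_iff\<close>) turns the
  matrix inequality of the lifted set into \<open>\<gamma> > 0\<close> together with the Riccati inequality
  \<open>F\<^sup>T P + P F + \<gamma>\<^sup>-\<^sup>1 (P B\<^sub>w B\<^sub>w\<^sup>T P + G) \<preceq> 0\<close> (\<open>L_inf_iff_riccati\<close>).

  That a solution \<open>P \<succ> 0\<close> certifies stability and the bound \<open>\<gamma>\<close> is the dissipation inequality, evaluated at an
  eigenvector of \<open>F\<close> and at a sinusoidal state.  The converse is the bounded real lemma
  (\<open>bounded_real_riccati\<close>), here for the non-strict bound, and it is obtained without spectral factorization because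
  \<open>B\<^sub>w\<close> is invertible.  The quadratic term then bounds all solutions, so the set of \<open>\<tau> \<in> [0, 1]\<close> for which the
  Riccati inequality with \<open>\<tau> G\<close> in place of \<open>G\<close> has a solution \<open>P \<succeq> 0\<close> is compact; it contains \<open>0\<close>.  If its maximum
  \<open>\<tau>\<close> were less than \<open>1\<close>, no \<open>P + \<epsilon> H \<succeq> 0\<close> would satisfy the inequality strictly.  By separation of convex
  sets (\<open>Lyapunov_alternative\<close>) the closed-loop matrix \<open>D = F + \<gamma>\<^sup>-\<^sup>1 B\<^sub>w B\<^sub>w\<^sup>T P\<close> would then have an eigenvector
  at which the Riccati form vanishes.  For \<open>\<tau> = 0\<close> one takes \<open>P = 0\<close>, the eigenvalue has nonnegative real part, and
  \<open>D = F\<close> is not Hurwitz.  For \<open>\<tau> > 0\<close> one has \<open>P \<succ> 0\<close>, the eigenvalue is imaginary, \<open>i \<omega>\<close>, and at the frequency \<open>\<omega>\<close> the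
  output attains the bound \<open>\<gamma>\<close> already for the weight \<open>\<tau> G\<close>, hence violates it for \<open>G\<close>.

  For the second statement, the congruence with \<open>diag(P\<^sup>-\<^sup>1, I, I, I)\<close> and \<open>Y = K P\<^sup>-\<^sup>1\<close>, \<open>X = P\<^sup>-\<^sup>1\<close> maps one matrix
  inequality to the other (\<open>L_inf_iff_F_inf\<close>), the second one is affine in \<open>(\<gamma>, Y, X)\<close>, and matrix inversion is smooth on the
  open set of invertible matrices (\<open>times_cont_diff_on_matrix_inv\<close>), which provides the extension of \<open>\<Phi>\<^sub>\<infinity>\<close> and its inverse.
\<close>

section \<open>Symmetric matrices and quadratic forms\<close>

lemma bounded_bilinear_matrix_mult:
  "bounded_bilinear ((**) :: real ^ 'q ^ 'p \<Rightarrow> real ^ 'r ^ 'q \<Rightarrow> real ^ 'r ^ 'p)"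
  unfolding bilinear_conv_bounded_bilinear[symmetric] bilinear_def
  by (auto intro!: linearI
      simp: matrix_matrix_mult_def vec_eq_iff sum.distrib algebra_simps sum_distrib_left)

lemmas matrix_mult_bilinear_simps =
  bounded_bilinear.add_left[OF bounded_bilinear_matrix_mult]
  bounded_bilinear.add_right[OF bounded_bilinear_matrix_mult]
  bounded_bilinear.diff_left[OF bounded_bilinear_matrix_mult]
  bounded_bilinear.diff_right[OF bounded_bilinear_matrix_mult]
  bounded_bilinear.minus_left[OF bounded_bilinear_matrix_mult]
  bounded_bilinear.minus_right[OF bounded_bilinear_matrix_mult]
  bounded_bilinear.zero_left[OF bounded_bilinear_matrix_mult]
  bounded_bilinear.zero_right[OF bounded_bilinear_matrix_mult]
  bounded_bilinear.scaleR_left[OF bounded_bilinear_matrix_mult]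
  bounded_bilinear.scaleR_right[OF bounded_bilinear_matrix_mult]

lemma transpose_simps:
  "transpose (M + N) = transpose M + transpose N" "transpose (M - N) = transpose M - transpose N"
  "transpose (- M) = - transpose M" "transpose 0 = 0"
  "transpose (c *\<^sub>R M) = c *\<^sub>R transpose M"
  for M N :: "real ^ 'q ^ 'p"
  by (simp_all add: transpose_def vec_eq_iff)

lemma matrix_vector_scaleR_left: "(k *\<^sub>R M) *v x = k *\<^sub>R (M *v x)" for M :: "real ^ 'q ^ 'p"
  by (rule scaleR_matrix_vector_assoc[symmetric])

lemma matrix_vector_minus_left: "(- M) *v x = - (M *v x)" for M :: "real ^ 'q ^ 'p"
  using matrix_vector_scaleR_left[of "-1" M x] by simp

lemmas matrix_vector_left_simps = matrix_vector_minus_left matrix_vector_mult_add_rdistrib matrix_vector_mult_diff_rdistrib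
  matrix_vector_scaleR_left

lemma inner_matrix_vector: "x \<bullet> (M *v y) = (transpose M *v x) \<bullet> y" for M :: "real ^ 'q ^ 'p"
  by (metis dot_lmul_matrix transpose_matrix_vector)

lemma inner_symmetric_matrix: "transpose M = M \<Longrightarrow> x \<bullet> (M *v y) = (M *v x) \<bullet> y" for M :: "real ^ 'n ^ 'n"
  by (simp add: inner_matrix_vector)

lemma nonneg_form_eq_0_imp_kernel:
  fixes T :: "'a::real_inner \<Rightarrow> 'a"
  assumes T: "linear T" and sym: "\<And>x y. T x \<bullet> y = x \<bullet> T y" and nonneg: "\<And>x. 0 \<le> x \<bullet> T x"
    and 0: "x \<bullet> T x = 0"
  shows "T x = 0"
proof (rule ccontr)
  assume "T x \<noteq> 0"
  define u c where "u = T x" and "c = T x \<bullet> T (T x)"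
  have u: "u \<bullet> u > 0" and c: "c \<ge> 0"
    using \<open>T x \<noteq> 0\<close> nonneg by (auto simp: u_def c_def)
  have *: "0 \<le> - 2 * s * (u \<bullet> u) + s\<^sup>2 * c" for s
  proof -
    have "T (x - s *\<^sub>R u) = u - s *\<^sub>R T u"
      using T by (simp add: u_def linear_diff linear_scale)
    moreover have "(x - s *\<^sub>R u) \<bullet> (u - s *\<^sub>R T u) = - 2 * s * (u \<bullet> u) + s\<^sup>2 * c"
      using 0 sym[of x u]
      by (simp add: inner_diff_left inner_diff_right u_def c_def power2_eq_square inner_commute)
    ultimately have "(x - s *\<^sub>R u) \<bullet> T (x - s *\<^sub>R u) = - 2 * s * (u \<bullet> u) + s\<^sup>2 * c"
      by simp
    then show ?thesis using nonneg by metis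
  qed
  \<comment> \<open>Decreasing along \<open>u\<close> is possible to first order; the step below is short enough for the
    quadratic term \<open>c\<close>.\<close>
  define s where "s = (u \<bullet> u) / (c + 1)"
  have s: "s > 0" "s * (c + 1) = u \<bullet> u"
    using u c by (auto simp: s_def)
  have "0 \<le> s * (s * c - 2 * (u \<bullet> u))"
    using *[of s] by (simp add: algebra_simps power2_eq_square)
  then have "0 \<le> s * c - 2 * (u \<bullet> u)"
    using s by (simp add: zero_le_mult_iff)
  moreover have "s + s * c = u \<bullet> u"
    using s(2) by (simp add: algebra_simps)
  ultimately show False
    using s(1) u by linarith
qed

lemma pos_semidef_kernel:
  assumes "pos_semidef M" "x \<bullet> (M *v x) = 0"
  shows "M *v x = 0"
proof (rule nonneg_form_eq_0_imp_kernel[where T = "(*v) M"])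
  show "linear ((*v) M)" by (rule matrix_vector_mul_linear)
qed (use assms in \<open>auto simp: pos_semidef_def inner_symmetric_matrix\<close>)

lemma pos_semidef_Cauchy_Schwarz:
  assumes "pos_semidef M"
  shows "(x \<bullet> (M *v y))\<^sup>2 \<le> (x \<bullet> (M *v x)) * (y \<bullet> (M *v y))"
proof (cases "y \<bullet> (M *v y) = 0")
  case True
  then show ?thesis using pos_semidef_kernel[OF assms] by force
next
  case False
  have sym: "y \<bullet> (M *v x) = x \<bullet> (M *v y)"
    using assms by (metis inner_commute inner_symmetric_matrix pos_semidef_def)
  define s where "s = (x \<bullet> (M *v y)) / (y \<bullet> (M *v y))"
  have pos: "y \<bullet> (M *v y) > 0" using False assms by (simp add: pos_semidef_def order_less_le)
  have "0 \<le> (x - s *\<^sub>R y) \<bullet> (M *v (x - s *\<^sub>R y))"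
    using assms by (simp add: pos_semidef_def)
  also have "\<dots> = x \<bullet> (M *v x) - 2 * s * (x \<bullet> (M *v y)) + s\<^sup>2 * (y \<bullet> (M *v y))"
    by (simp add: matrix_vector_mult_diff_distrib matrix_vector_scaleR_left
        matrix_vector_mult_scaleR inner_diff algebra_simps power2_eq_square sym)
  also have "\<dots> = x \<bullet> (M *v x) - (x \<bullet> (M *v y))\<^sup>2 / (y \<bullet> (M *v y))"
    using pos by (simp add: s_def field_simps power2_eq_square)
  finally show ?thesis using pos by (simp add: field_simps)
qed

lemma matrix_vector_norm_bound:
  fixes M :: "real ^ 'q ^ 'p"
  obtains c where "c > 0" "\<And>x. norm (M *v x) \<le> c * norm x"
  by (metis bounded_linear.pos_bounded matrix_vector_mul_bounded_linear mult.commute)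

text \<open>Compactness of the unit sphere makes a positive definite form coercive.\<close>

lemma pos_def_coercive:
  assumes "pos_def M"
  obtains c where "c > 0" "\<And>x. c * (x \<bullet> x) \<le> x \<bullet> (M *v x)"
proof -
  have "continuous_on (sphere 0 1) (\<lambda>x. x \<bullet> (M *v x))"
    by (intro continuous_intros)
  moreover have "axis undefined 1 \<in> sphere (0 :: real ^ 'a) 1"
    by simp
  ultimately obtain x where x: "x \<in> sphere 0 1" "\<And>y. y \<in> sphere 0 1 \<Longrightarrow> x \<bullet> (M *v x) \<le> y \<bullet> (M *v y)"
    using continuous_attains_inf[OF compact_sphere, of 0 1 "\<lambda>x. x \<bullet> (M *v x)"] by blast
  show thesis
  proof
    show "x \<bullet> (M *v x) > 0"
    proof -
      have "x \<noteq> 0" using x(1) by auto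
      then show ?thesis using assms by (simp add: pos_def_def)
    qed
    fix y
    show "(x \<bullet> (M *v x)) * (y \<bullet> y) \<le> y \<bullet> (M *v y)"
    proof (cases "y = 0")
      case False
      have "x \<bullet> (M *v x) \<le> sgn y \<bullet> (M *v sgn y)"
        using False by (intro x(2)) (simp add: norm_sgn)
      also have "\<dots> = (y \<bullet> (M *v y)) / (y \<bullet> y)"
        using False by (simp add: sgn_div_norm matrix_vector_mult_scaleR dot_square_norm power2_eq_square field_simps)
      finally show ?thesis using False by (simp add: field_simps)
    qed auto
  qed
qed

lemma invertible_imp_norm_bound_below:
  fixes M :: "real ^ 'n ^ 'n"
  assumes "invertible M"
  obtains c where "c > 0" "\<And>x. norm x \<le> c * norm (M *v x)"
proof -
  obtain M' where M': "M' ** M = mat 1"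
    using assms invertible_def by blast
  obtain c where "c > 0" "\<And>x. norm (M' *v x) \<le> c * norm x"
    using matrix_vector_norm_bound by blast
  then show thesis
    using that[of c] M' by (metis matrix_vector_mul_assoc matrix_vector_mul_lid)
qed

lemma pos_def_imp_pos_semidef: "pos_def M \<Longrightarrow> pos_semidef M"
  unfolding pos_def_def pos_semidef_def by (metis inner_zero_left order_le_less)

lemma pos_def_imp_invertible: "pos_def M \<Longrightarrow> invertible M"
  unfolding invertible_left_inverse matrix_left_invertible_ker pos_def_def
  by (metis inner_zero_right less_irrefl)

lemma matrix_inv_mult_left: "invertible M \<Longrightarrow> matrix_inv M ** M = mat 1"
  and matrix_inv_mult_right: "invertible M \<Longrightarrow> M ** matrix_inv M = mat 1"
  for M :: "'a::field ^ 'n ^ 'n"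
  unfolding matrix_inv_def invertible_def by (metis (mono_tags, lifting) someI_ex)+

lemma matrix_inv_unique: "M ** N = mat 1 \<Longrightarrow> matrix_inv M = N" for M N :: "'a::field ^ 'n ^ 'n"
  by (metis invertible_def matrix_inv_mult_left matrix_left_right_inverse matrix_mul_assoc matrix_mul_lid matrix_mul_rid)

lemma matrix_inv_invertible: "invertible M \<Longrightarrow> invertible (matrix_inv M)" for M :: "'a::field ^ 'n ^ 'n"
  using invertible_def matrix_inv_mult_left matrix_inv_mult_right by blast

lemma matrix_inv_matrix_inv: "invertible M \<Longrightarrow> matrix_inv (matrix_inv M) = M" for M :: "'a::field ^ 'n ^ 'n"
  by (simp add: matrix_inv_mult_left matrix_inv_unique)

lemma transpose_matrix_inv:
  fixes M :: "'a::field ^ 'n ^ 'n"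
  assumes "invertible M" "transpose M = M"
  shows "transpose (matrix_inv M) = matrix_inv M"
  by (metis assms matrix_inv_mult_left matrix_inv_unique matrix_transpose_mul transpose_mat)

lemma pos_def_matrix_inv:
  assumes "pos_def M" shows "pos_def (matrix_inv M)"
  unfolding pos_def_def
proof safe
  have inv: "invertible M" using assms by (rule pos_def_imp_invertible)
  then show "transpose (matrix_inv M) = matrix_inv M"
    using assms transpose_matrix_inv by (auto simp: pos_def_def)
  fix x :: "real ^ 'a" assume "x \<noteq> 0"
  define y where "y = matrix_inv M *v x"
  have x: "x = M *v y" by (simp add: y_def matrix_vector_mul_assoc matrix_inv_mult_right inv)
  then have "y \<noteq> 0" using \<open>x \<noteq> 0\<close> by auto
  have "x \<bullet> (matrix_inv M *v x) = y \<bullet> (M *v y)"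
    using x by (simp add: y_def inner_commute)
  then show "0 < x \<bullet> (matrix_inv M *v x)"
    using \<open>y \<noteq> 0\<close> assms by (simp add: pos_def_def)
qed

section \<open>Square roots and the trace form\<close>

text \<open>Existence of the square root by Banach's fixed point theorem, without diagonalization.\<close>

lemma pos_def_sqrt_exists:
  fixes Q :: "real ^ 'n ^ 'n"
  assumes "pos_def Q"
  obtains S where "pos_def S" "S ** S = Q"
proof -
  have sym: "(Q *v x) \<bullet> y = x \<bullet> (Q *v y)" for x y
    using assms by (simp add: pos_def_def inner_symmetric_matrix)
  obtain q where q: "q > 0" "\<And>x. q * (x \<bullet> x) \<le> x \<bullet> (Q *v x)"
    using pos_def_coercive[OF assms] by blast
  obtain m0 where m0: "m0 > 0" "\<And>x. norm (Q *v x) \<le> m0 * norm x"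
    using matrix_vector_norm_bound by blast
  define m where "m = max m0 q"
  have m: "m > 0" "q \<le> m" "\<And>x. norm (Q *v x) \<le> m * norm x"
    using m0 by (auto simp: m_def intro!: order_trans[OF m0(2)] mult_right_mono)
  \<comment> \<open>This \<open>c\<close> minimizes the bound \<open>1 - 2 c q + c\<^sup>2 m\<^sup>2\<close> for \<open>\<parallel>I - c Q\<parallel>\<^sup>2\<close>.\<close>
  define c a where "c = q / m\<^sup>2" and "a = sqrt (1 - q\<^sup>2 / m\<^sup>2)"
  have c: "c > 0" using q m by (simp add: c_def)
  have a2: "a\<^sup>2 = 1 - q\<^sup>2 / m\<^sup>2"
    using m q by (simp add: a_def power_mono)
  have a: "0 \<le> a" "a < 1"
    using m q by (auto simp: a_def power_mono)
  define E where "E = id_blinfun - c *\<^sub>R Blinfun ((*v) Q)"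
  have E: "E x = x - c *\<^sub>R (Q *v x)" for x
    by (simp add: E_def blinfun.diff_left blinfun.scaleR_left bounded_linear_Blinfun_apply)
  have normE: "norm E \<le> a"
  proof (rule norm_blinfun_bound)
    fix x
    have "(norm (E x))\<^sup>2 = x \<bullet> x - 2 * c * (x \<bullet> (Q *v x)) + c\<^sup>2 * (norm (Q *v x))\<^sup>2"
      unfolding E power2_norm_eq_inner
      by (simp add: inner_diff algebra_simps power2_eq_square inner_commute)
    also have "\<dots> \<le> x \<bullet> x - 2 * c * (q * (x \<bullet> x)) + c\<^sup>2 * (m * norm x)\<^sup>2"
      using c q(2)[of x] m(3)[of x] by (intro add_mono diff_mono mult_left_mono power_mono) auto
    also have "\<dots> = (1 - 2 * c * q + c\<^sup>2 * m\<^sup>2) * (norm x)\<^sup>2"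
      by (simp add: power2_norm_eq_inner algebra_simps)
    also have "1 - 2 * c * q + c\<^sup>2 * m\<^sup>2 = a\<^sup>2"
      unfolding a2 using m(1) by (simp add: c_def field_simps power2_eq_square)
    finally show "norm (E x) \<le> a * norm x"
      by (metis a(1) mult_nonneg_nonneg norm_ge_zero power2_le_imp_le power_mult_distrib)
  qed (use a in auto)
  \<comment> \<open>The square root of \<open>c Q = I - E\<close> is \<open>I - Y\<close>, where \<open>Y\<close> is the fixed point of \<open>\<Phi>\<close>:
    \<open>(I - Y)\<^sup>2 = I - 2 Y + Y\<^sup>2\<close> and \<open>2 Y = E + Y\<^sup>2\<close>.\<close>
  define D where "D = {Y :: (real ^ 'n) \<Rightarrow>\<^sub>L (real ^ 'n). norm Y \<le> a \<and> (\<forall>x y. blinfun_apply Y x \<bullet> y = x \<bullet> blinfun_apply Y y)}"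
  define \<Phi> where "\<Phi> Y = (1/2) *\<^sub>R (E + (Y o\<^sub>L Y))" for Y :: "(real ^ 'n) \<Rightarrow>\<^sub>L (real ^ 'n)"
  have "\<exists>!Y. Y \<in> D \<and> \<Phi> Y = Y"
  proof (rule Banach_fix)
    have "D = cball 0 a \<inter> (\<Inter>x. \<Inter>y. {Y :: (real ^ 'n) \<Rightarrow>\<^sub>L (real ^ 'n). blinfun_apply Y x \<bullet> y = x \<bullet> blinfun_apply Y y})"
      by (auto simp: D_def)
    also have "closed \<dots>"
      by (intro closed_Int closed_INT ballI closed_Collect_eq continuous_intros closed_cball)
    finally show "complete D" by (simp add: complete_eq_closed)
    show "D \<noteq> {}" using a by (auto simp: D_def intro!: exI[of _ 0])
    show "\<Phi> ` D \<subseteq> D"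
    proof safe
      fix Y assume Y: "Y \<in> D"
      have "norm (E + (Y o\<^sub>L Y)) \<le> a + a * a"
        using Y a by (intro norm_triangle_mono normE order_trans[OF norm_blinfun_compose] mult_mono)
          (auto simp: D_def)
      also have "a * a \<le> a * 1" using a by (intro mult_left_mono) auto
      finally have "norm (\<Phi> Y) \<le> a"
        by (simp add: \<Phi>_def)
      moreover have "\<Phi> Y x \<bullet> y = x \<bullet> \<Phi> Y y" for x y
        using Y by (simp add: \<Phi>_def D_def blinfun.add_left blinfun.scaleR_left E inner_diff
            inner_add sym)
      ultimately show "\<Phi> Y \<in> D" by (simp add: D_def)
    qed
    show "dist (\<Phi> Y) (\<Phi> Z) \<le> a * dist Y Z" if Y: "Y \<in> D" and Z: "Z \<in> D" for Y Z
    proof -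
      have "\<Phi> Y - \<Phi> Z = (1/2) *\<^sub>R ((Y o\<^sub>L (Y - Z)) + ((Y - Z) o\<^sub>L Z))"
        by (rule blinfun_eqI)
          (simp add: \<Phi>_def blinfun.bilinear_simps scaleR_diff_right scaleR_add_right)
      also have "norm \<dots> \<le> (1/2) * (a * norm (Y - Z) + norm (Y - Z) * a)"
        unfolding norm_scaleR
        using Y Z a
        by (intro mult_mono norm_triangle_mono order_trans[OF norm_blinfun_compose])
          (auto simp: D_def)
      finally show "dist (\<Phi> Y) (\<Phi> Z) \<le> a * dist Y Z"
        by (simp add: dist_norm)
    qed
  qed (use a in auto)
  then obtain Y where Y: "Y \<in> D" "\<Phi> Y = Y" by blast
  define T where "T x = (1 / sqrt c) *\<^sub>R (x - Y x)" for x
  have lin: "linear T"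
    unfolding T_def by (intro linearI) (auto simp: blinfun.bilinear_simps algebra_simps)
  have TT: "T (T x) = Q *v x" for x
  proof -
    have "2 *\<^sub>R Y x = 2 *\<^sub>R (\<Phi> Y x)" using Y by simp
    also have "\<dots> = x - c *\<^sub>R (Q *v x) + Y (Y x)"
      by (simp add: \<Phi>_def blinfun.bilinear_simps E)
    finally have "x - Y x - Y (x - Y x) = c *\<^sub>R (Q *v x)"
      by (simp add: blinfun.bilinear_simps algebra_simps scaleR_2)
    moreover have "T (T x) = (1 / c) *\<^sub>R (x - Y x - Y (x - Y x))"
      using c by (simp add: T_def blinfun.bilinear_simps scaleR_diff_right[symmetric])
    ultimately show ?thesis using c by simp
  qed
  show thesis
  proof
    have mT: "matrix T *v x = T x" for x
      using lin by (simp add: matrix_works)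
    show "matrix T ** matrix T = Q"
      by (simp add: matrix_eq matrix_vector_mul_assoc[symmetric] mT TT)
    have "T x \<bullet> y = x \<bullet> T y" for x y
      using Y by (simp add: T_def D_def inner_diff)
    then have "transpose (matrix T) = matrix T"
      by (metis adjoint_matrix adjoint_unique mT matrix_of_matrix_vector_mul)
    moreover have "0 < x \<bullet> T x" if "x \<noteq> 0" for x
    proof -
      have "x \<bullet> Y x \<le> norm x * (a * norm x)"
        using Y by (intro order_trans[OF norm_cauchy_schwarz] mult_left_mono order_trans[OF norm_blinfun] mult_right_mono)
          (auto simp: D_def)
      also have "\<dots> = a * (x \<bullet> x)"
        by (simp add: dot_square_norm power2_eq_square)
      also have "\<dots> < 1 * (x \<bullet> x)" using a that by (intro mult_strict_right_mono) auto
      finally show ?thesis using c by (simp add: T_def inner_diff_right)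
    qed
    ultimately show "pos_def (matrix T)"
      by (simp add: pos_def_def mT)
  qed
qed

lemma pos_semidef_congruence:
  assumes "pos_semidef M"
  shows "pos_semidef (transpose C ** M ** C)"
proof -
  have "x \<bullet> ((transpose C ** M ** C) *v x) = (C *v x) \<bullet> (M *v (C *v x))" for x
    by (metis inner_matrix_vector matrix_vector_mul_assoc transpose_transpose)
  then show ?thesis
    using assms by (simp add: pos_semidef_def matrix_transpose_mul matrix_mul_assoc)
qed

lemma trace_eq_sum_inner: "trace M = (\<Sum>i\<in>UNIV. axis i 1 \<bullet> (M *v axis i 1))" for M :: "real ^ 'n ^ 'n"
  by (simp add: trace_def inner_axis' matrix_vector_mult_basis column_def)

lemma pos_semidef_trace_nonneg: "pos_semidef M \<Longrightarrow> 0 \<le> trace M"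
  unfolding trace_eq_sum_inner pos_semidef_def by (auto intro: sum_nonneg)

lemma matrix_eq_0_iff_axis: "M = 0 \<longleftrightarrow> (\<forall>i. M *v axis i 1 = 0)" for M :: "real ^ 'q ^ 'p"
  by (auto simp: matrix_vector_mult_basis column_def vec_eq_iff)

lemma pos_semidef_trace_0:
  assumes "pos_semidef M" "trace M = 0"
  shows "M = 0"
proof -
  have "axis i 1 \<bullet> (M *v axis i 1) = 0" for i
    using assms unfolding trace_eq_sum_inner pos_semidef_def
    by (subst (asm) sum_nonneg_eq_0_iff) auto
  then show ?thesis
    using pos_semidef_kernel[OF assms(1)] by (auto simp: matrix_eq_0_iff_axis)
qed

text \<open>With \<open>D = S - T\<close>, equality of the squares reads \<open>S D + D T = 0\<close>; hence the traces of the positive semidefinite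
  matrices \<open>D S D\<close> and \<open>D T D\<close> add up to zero.\<close>

lemma pos_semidef_sqrt_unique:
  assumes S: "pos_def S" and T: "pos_semidef T" and eq: "S ** S = T ** T"
  shows "T = S"
proof -
  define D where "D = S - T"
  have symD: "transpose D = D"
    using S T by (simp add: D_def pos_def_def pos_semidef_def transpose_simps)
  have "S ** D + D ** T = 0"
    using eq by (simp add: D_def matrix_mult_bilinear_simps)
  then have "trace (D ** (S ** D + D ** T)) = 0"
    by (simp add: matrix_mult_bilinear_simps trace_def)
  then have "trace (D ** S ** D) + trace (D ** (D ** T)) = 0"
    by (simp add: matrix_mult_bilinear_simps matrix_mul_assoc trace_add)
  moreover have "trace (D ** (D ** T)) = trace (D ** T ** D)"
    by (rule trace_mul_sym)
  ultimately have "trace (D ** S ** D) + trace (D ** T ** D) = 0"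
    by simp
  moreover have "pos_semidef (D ** S ** D)" "pos_semidef (D ** T ** D)"
    using S T pos_semidef_congruence[of _ D] pos_def_imp_pos_semidef symD by metis+
  ultimately have "D ** S ** D = 0"
    using pos_semidef_trace_nonneg pos_semidef_trace_0
    by (metis add_nonneg_eq_0_iff)
  moreover have "(D *v x) \<bullet> (S *v (D *v x)) = x \<bullet> ((D ** S ** D) *v x)" for x
    by (simp only: matrix_vector_mul_assoc[symmetric] inner_symmetric_matrix[OF symD])
  ultimately have "(D *v x) \<bullet> (S *v (D *v x)) = 0" for x
    by simp
  then have "D *v x = 0" for x
    using S by (metis less_irrefl pos_def_def)
  then show ?thesis
    by (simp add: D_def matrix_eq matrix_vector_mult_diff_rdistrib)
qed

lemma mat_sqrt:
  assumes "pos_def Q"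
  shows "pos_def (mat_sqrt Q)" and "mat_sqrt Q ** mat_sqrt Q = Q"
proof -
  obtain S where S: "pos_def S" "S ** S = Q"
    using pos_def_sqrt_exists[OF assms] .
  then have "mat_sqrt Q = S"
    unfolding mat_sqrt_def
    by (intro the_equality) (auto simp: pos_def_imp_pos_semidef intro: pos_semidef_sqrt_unique)
  with S show "pos_def (mat_sqrt Q)" "mat_sqrt Q ** mat_sqrt Q = Q" by auto
qed

text \<open>The trace form on symmetric matrices is nonnegative on pairs of positive semidefinite matrices.\<close>

lemma inner_eq_trace: "A \<bullet> B = trace (transpose A ** B)" for A B :: "real ^ 'q ^ 'p"
  by (simp add: inner_vec_def trace_def matrix_matrix_mult_def transpose_def) (rule sum.swap)

lemma pos_def_add_scaleR_id:
  "pos_semidef M \<Longrightarrow> e > 0 \<Longrightarrow> pos_def (M + e *\<^sub>R mat 1)"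
  unfolding pos_def_def pos_semidef_def
  by (auto simp: transpose_simps matrix_vector_mult_add_rdistrib
      matrix_vector_scaleR_left inner_add add_nonneg_pos)

lemma pos_semidef_inner_nonneg:
  fixes M Z :: "real ^ 'n ^ 'n"
  assumes Z: "pos_semidef Z" and M: "pos_semidef M"
  shows "0 \<le> Z \<bullet> M"
proof -
  have *: "0 \<le> Z \<bullet> M'" if M': "pos_def M'" for M'
  proof -
    obtain S where S: "pos_def S" "S ** S = M'"
      using pos_def_sqrt_exists[OF M'] .
    have "Z \<bullet> M' = trace (Z ** S ** S)"
      using Z S by (simp add: inner_eq_trace pos_semidef_def matrix_mul_assoc[symmetric])
    also have "\<dots> = trace (transpose S ** Z ** S)"
      using S(1) trace_mul_sym[of "Z ** S" S] by (simp add: matrix_mul_assoc pos_def_def)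
    also have "\<dots> \<ge> 0"
      by (intro pos_semidef_trace_nonneg pos_semidef_congruence Z)
    finally show ?thesis .
  qed
  \<comment> \<open>A semidefinite \<open>M\<close> is the limit of the definite matrices \<open>M + e I\<close>.\<close>
  have "((\<lambda>e. Z \<bullet> (M + e *\<^sub>R mat 1)) \<longlongrightarrow> Z \<bullet> (M + 0 *\<^sub>R mat 1)) (at_right 0)"
    by (intro tendsto_intros)
  then have "0 \<le> Z \<bullet> (M + 0 *\<^sub>R mat 1)"
    by (rule tendsto_lowerbound) (auto simp: eventually_at_right_less intro!: eventually_at_rightI[of 0 1] * pos_def_add_scaleR_id M)
  then show ?thesis by simp
qed

lemma pos_def_inner_0:
  fixes M Z :: "real ^ 'n ^ 'n"
  assumes Z: "pos_semidef Z" and M: "pos_def M" and 0: "Z \<bullet> M = 0"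
  shows "Z = 0"
proof -
  obtain c where c: "c > 0" "\<And>x. c * (x \<bullet> x) \<le> x \<bullet> (M *v x)"
    using pos_def_coercive[OF M] by blast
  have "pos_semidef (M - c *\<^sub>R mat 1)"
    using M c unfolding pos_def_def pos_semidef_def
    by (auto simp: transpose_simps matrix_vector_mult_diff_rdistrib
        matrix_vector_scaleR_left inner_diff)
  then have "0 \<le> Z \<bullet> (M - c *\<^sub>R mat 1)"
    by (rule pos_semidef_inner_nonneg[OF Z])
  also have "\<dots> = - c * trace Z"
    using 0 Z by (simp add: inner_diff inner_eq_trace[of Z "mat 1"] pos_semidef_def)
  finally have "trace Z = 0"
    using c pos_semidef_trace_nonneg[OF Z] by (simp add: mult_le_0_iff)
  then show ?thesis using Z by (simp add: pos_semidef_trace_0)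
qed

text \<open>If two positive semidefinite matrices are orthogonal, then the form of the second one vanishes
  on the range of the first one.\<close>

text \<open>The rank-one matrix \<open>v v\<^sup>T\<close>, through the properties that characterize it here.\<close>

lemma outer_product:
  fixes v :: "real ^ 'n"
  obtains W where "\<And>x. W *v x = (v \<bullet> x) *\<^sub>R v" "\<And>M. W \<bullet> M = v \<bullet> (M *v v)" "pos_semidef W"
proof
  define W where "W = (\<chi> i j. v $ i * v $ j)"
  show W: "W *v x = (v \<bullet> x) *\<^sub>R v" for x
    by (simp add: W_def vec_eq_iff matrix_vector_mult_def inner_vec_def sum_distrib_left sum_distrib_right mult_ac)
  show "W \<bullet> M = v \<bullet> (M *v v)" for M
    by (simp add: W_def inner_vec_def matrix_vector_mult_def sum_distrib_left mult_ac)
  show "pos_semidef W"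
    unfolding pos_semidef_def
    by (simp add: W inner_commute) (simp add: transpose_def W_def vec_eq_iff mult_ac)
qed

lemma pos_semidef_inner_0_range:
  fixes M Z :: "real ^ 'n ^ 'n"
  assumes Z: "pos_semidef Z" and M: "pos_semidef M" and 0: "Z \<bullet> M = 0"
  shows "(Z *v u) \<bullet> (M *v (Z *v u)) = 0"
proof -
  define v where "v = Z *v u"
  obtain W where W: "\<And>x. W *v x = (v \<bullet> x) *\<^sub>R v" "\<And>M. W \<bullet> M = v \<bullet> (M *v v)" "pos_semidef W"
    using outer_product[of v] by blast
  define k where "k = u \<bullet> v + 1"
  have k: "k > 0" using Z by (auto simp: k_def v_def pos_semidef_def intro: add_nonneg_pos)
  \<comment> \<open>By Cauchy-Schwarz, \<open>v v\<^sup>T \<preceq> k Z\<close>.\<close>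
  have "pos_semidef (k *\<^sub>R Z - W)"
    unfolding pos_semidef_def
  proof safe
    show "transpose (k *\<^sub>R Z - W) = k *\<^sub>R Z - W"
      using Z W(3) by (simp add: pos_semidef_def transpose_simps)
    fix x
    have "(x \<bullet> v)\<^sup>2 \<le> (x \<bullet> (Z *v x)) * (u \<bullet> v)"
      unfolding v_def by (rule pos_semidef_Cauchy_Schwarz[OF Z])
    also have "\<dots> \<le> (x \<bullet> (Z *v x)) * k"
      using Z by (intro mult_left_mono) (auto simp: k_def pos_semidef_def)
    finally show "0 \<le> x \<bullet> ((k *\<^sub>R Z - W) *v x)"
      by (simp add: matrix_vector_mult_diff_rdistrib W(1) inner_diff matrix_vector_scaleR_left
          power2_eq_square mult_ac inner_commute)
  qed
  from pos_semidef_inner_nonneg[OF this M] have "v \<bullet> (M *v v) \<le> 0"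
    by (simp add: inner_diff 0 W(2))
  then show ?thesis using M by (simp add: pos_semidef_def v_def order_antisym)
qed

section \<open>Eigenvectors of complex matrices and of real invariant subspaces\<close>

text \<open>The vector \<open>p(M) v\<close> for a polynomial \<open>p\<close>, evaluated by Horner's scheme.\<close>

definition poly_mat_vec :: "'a::field ^ 'n ^ 'n \<Rightarrow> 'a poly \<Rightarrow> 'a ^ 'n \<Rightarrow> 'a ^ 'n"
  where "poly_mat_vec M p v = fold_coeffs (\<lambda>a x. a *s v + M *v x) p 0"

lemma poly_mat_vec_0 [simp]: "poly_mat_vec M 0 v = 0"
  by (simp add: poly_mat_vec_def)

lemma poly_mat_vec_pCons [simp]:
  "poly_mat_vec M (pCons a p) v = a *s v + M *v poly_mat_vec M p v"
  by (cases "a = 0 \<and> p = 0") (auto simp: poly_mat_vec_def)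

lemma poly_mat_vec_add: "poly_mat_vec M (p + q) v = poly_mat_vec M p v + poly_mat_vec M q v"
  by (induction p q rule: poly_induct2)
    (simp_all add: vector_sadd_rdistrib matrix_vector_right_distrib)

lemma poly_mat_vec_smult: "poly_mat_vec M (smult c p) v = c *s poly_mat_vec M p v"
  by (induction p) (simp_all add: vector_add_ldistrib vec.linear_scale vec.scale_right_distrib
      vector_scalar_commute)

lemma poly_mat_vec_sum: "poly_mat_vec M (sum p I) v = (\<Sum>i\<in>I. poly_mat_vec M (p i) v)"
  by (induction I rule: infinite_finite_induct) (simp_all add: poly_mat_vec_add)

lemma poly_mat_vec_monom: "poly_mat_vec M (monom c k) v = c *s ((((*v) M) ^^ k) v)"
  by (induction k) (simp_all add: monom_0 monom_Suc vector_scalar_commute)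

lemma poly_mat_vec_linear_factor:
  "poly_mat_vec M ([:- r, 1:] * q) v = M *v poly_mat_vec M q v - r *s poly_mat_vec M q v"
proof -
  have "[:- r, 1:] * q = smult (- r) q + pCons 0 q"
    by simp
  then show ?thesis
    by (simp only: poly_mat_vec_add poly_mat_vec_smult) (simp add: vector_smult_lneg)
qed

lemma poly_mat_vec_mem:
  assumes "v \<in> W" "0 \<in> W" "\<And>x y. x \<in> W \<Longrightarrow> y \<in> W \<Longrightarrow> x + y \<in> W"
    and "\<And>c x. x \<in> W \<Longrightarrow> c *s x \<in> W" "\<And>x. x \<in> W \<Longrightarrow> M *v x \<in> W"
  shows "poly_mat_vec M p v \<in> W"
  by (induction p) (use assms in auto)

lemma annihilating_poly_exists:
  fixes M :: "'a::field ^ 'n ^ 'n"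
  obtains p where "p \<noteq> 0" "poly_mat_vec M p v = 0"
proof -
  define f where "f k = (((*v) M) ^^ k) v" for k
  show thesis
  proof (cases "inj_on f {..CARD('n)}")
    case False
    then obtain i j where ij: "i \<noteq> j" "f i = f j" by (auto simp: inj_on_def)
    show thesis
    proof
      show "monom 1 i - monom 1 j \<noteq> (0 :: 'a poly)"
        using ij by (metis coeff_monom eq_iff_diff_eq_0 zero_neq_one)
      have "poly_mat_vec M (monom 1 i + monom (- 1) j) v = 0"
        using ij by (simp add: poly_mat_vec_add poly_mat_vec_monom f_def vector_smult_lneg)
      then show "poly_mat_vec M (monom 1 i - monom 1 j) v = 0"
        by (metis add_uminus_conv_diff minus_monom)
    qed
  next
    case True
    have "card (f ` {..CARD('n)}) > vec.dim (f ` {..CARD('n)})"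
      using True by (auto simp: card_image intro: le_less_trans[OF dim_subset_UNIV_cart_gen])
    then have "vec.dependent (f ` {..CARD('n)})"
      by (intro vec.dependent_biggerset_general)
    then obtain u where u: "\<exists>w\<in>f ` {..CARD('n)}. u w \<noteq> 0" "(\<Sum>w\<in>f ` {..CARD('n)}. u w *s w) = 0"
      by (subst (asm) vec.dependent_finite) auto
    define p where "p = (\<Sum>i\<le>CARD('n). monom (u (f i)) i)"
    show thesis
    proof
      have "coeff p i = u (f i)" if "i \<le> CARD('n)" for i
        using that by (simp add: p_def coeff_sum)
      with u(1) show "p \<noteq> 0" by auto
      have "poly_mat_vec M p v = (\<Sum>i\<le>CARD('n). u (f i) *s f i)"
        by (simp add: p_def poly_mat_vec_sum poly_mat_vec_monom f_def)
      also have "\<dots> = 0"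
        using u(2) by (simp add: sum.reindex[OF True])
      finally show "poly_mat_vec M p v = 0" .
    qed
  qed
qed

text \<open>If \<open>p(M) v = 0\<close> with \<open>p\<close> of least degree, \<open>r\<close> is a root of \<open>p\<close> and \<open>p = (X - r) q\<close>, then \<open>q(M) v\<close> is an
  eigenvector.\<close>

lemma invariant_subspace_eigenvector:
  fixes M :: "complex ^ 'n ^ 'n"
  assumes "v \<in> W" "v \<noteq> 0" "\<And>x y. x \<in> W \<Longrightarrow> y \<in> W \<Longrightarrow> x + y \<in> W"
    and "\<And>c x. x \<in> W \<Longrightarrow> c *s x \<in> W" "\<And>x. x \<in> W \<Longrightarrow> M *v x \<in> W"
  obtains l u where "u \<in> W" "u \<noteq> 0" "M *v u = l *s u"
proof -
  have W0: "0 \<in> W" using assms(4)[OF assms(1), of 0] by simp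
  have "\<exists>l u. u \<in> W \<and> u \<noteq> 0 \<and> M *v u = l *s u" if "p \<noteq> 0" "poly_mat_vec M p v = 0" for p
    using that
  proof (induction "degree p" arbitrary: p)
    case 0
    then obtain a where "p = [:a:]" "a \<noteq> 0" by (metis degree_eq_zeroE pCons_0_0)
    with 0 assms(2) show ?case by simp
  next
    case (Suc k)
    then have "\<not> constant (poly p)" by (simp add: constant_degree)
    then obtain r where "poly p r = 0" using fundamental_theorem_of_algebra by blast
    then obtain q where q: "p = [:- r, 1:] * q" by (metis dvdE poly_eq_0_iff_dvd)
    define u where "u = poly_mat_vec M q v"
    show ?case
    proof (cases "u = 0")
      case True
      have "q \<noteq> 0" using q Suc by auto
      then have "degree p = Suc (degree q)" unfolding q by (subst degree_mult_eq) auto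
      with Suc True \<open>q \<noteq> 0\<close> show ?thesis by (simp add: u_def)
    next
      case False
      have "M *v u = r *s u"
        using Suc.prems(2) unfolding q u_def by (simp only: poly_mat_vec_linear_factor) simp
      moreover have "u \<in> W"
        unfolding u_def by (intro poly_mat_vec_mem assms W0)
      ultimately show ?thesis using False by blast
    qed
  qed
  then show thesis using annihilating_poly_exists that by metis
qed

lemma eigenvalues_nonempty: "eigenvalues M \<noteq> {}"
proof -
  obtain i :: 'a where True by simp
  have "axis i (1::complex) \<noteq> 0" by (simp add: axis_eq_0_iff)
  then obtain l u where "u \<noteq> 0" "M *v u = l *s u"
    using invariant_subspace_eigenvector[of "axis i 1" UNIV] by blast
  then show ?thesis by (auto simp: eigenvalues_def)
qed

lemma eigenvalue_iff_det: "l \<in> eigenvalues M \<longleftrightarrow> det (mat l - M) = 0"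
proof -
  have "mat l *v v = l *s v" for v :: "complex ^ 'a"
    by (simp add: vec_eq_iff matrix_vector_mult_def mat_def if_distrib if_distribR cong: if_cong)
  then have "l \<in> eigenvalues M \<longleftrightarrow> \<not> (\<forall>v. (mat l - M) *v v = 0 \<longrightarrow> v = 0)"
    by (simp add: eigenvalues_def matrix_vector_mult_diff_rdistrib) metis
  also have "\<dots> \<longleftrightarrow> \<not> invertible (mat l - M)"
    by (simp add: invertible_left_inverse matrix_left_invertible_ker)
  finally show ?thesis by (simp add: invertible_det_nz)
qed

text \<open>The characteristic polynomial does not vanish at a number larger than the norm of \<open>M\<close>, so it has finitely many
  roots.\<close>

lemma eigenvalues_finite: "finite (eigenvalues M)"
proof -
  define p where "p = det (\<chi> i j. if i = j then [:- M $ i $ j, 1:] else [:- M $ i $ j:])"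
  have p: "poly p l = det (mat l - M)" for l
    unfolding p_def det_def
    by (auto simp: poly_sum poly_prod mat_def intro!: sum.cong prod.cong)
  obtain c where c: "\<And>v. norm (M *v v) \<le> c * norm v"
    by (metis bounded_linear.bounded matrix_vector_mul_bounded_linear mult.commute)
  have "complex_of_real (\<bar>c\<bar> + 1) \<notin> eigenvalues M"
  proof
    assume "complex_of_real (\<bar>c\<bar> + 1) \<in> eigenvalues M"
    then obtain v where v: "v \<noteq> 0" "M *v v = complex_of_real (\<bar>c\<bar> + 1) *s v"
      by (auto simp: eigenvalues_def)
    have "complex_of_real (\<bar>c\<bar> + 1) *s v = (\<bar>c\<bar> + 1) *\<^sub>R v"
      unfolding vec_eq_iff vector_smult_component vector_scaleR_component
      by (simp add: scaleR_conv_of_real)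
    then have "(\<bar>c\<bar> + 1) * norm v \<le> c * norm v"
      using c[of v] v by simp
    then show False using v by (simp add: mult_le_cancel_right)
  qed
  then have "p \<noteq> 0"
    using p eigenvalue_iff_det by (metis poly_0)
  moreover have "eigenvalues M = {l. poly p l = 0}"
    using p eigenvalue_iff_det by auto
  ultimately show ?thesis by (simp add: poly_roots_finite)
qed

text \<open>The maximum in the definition of stabilizing gains is over a finite nonempty set.\<close>

lemma stabilizing_iff:
  "K \<in> stabilizing A B \<longleftrightarrow> (\<forall>l\<in>eigenvalues (cmat (A + B ** K)). Re l < 0)"
  unfolding stabilizing_def
  using Max_less_iff[of "Re ` eigenvalues (cmat (A + B ** K))" 0]
  by (simp add: eigenvalues_finite eigenvalues_nonempty)

text \<open>A complex vector is handled through its real and imaginary part.\<close>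

definition cvec :: "real ^ 'n \<Rightarrow> real ^ 'n \<Rightarrow> complex ^ 'n"
  where "cvec x y = (\<chi> i. Complex (x $ i) (y $ i))"

lemma cvec_cases: obtains x y where "v = cvec x y"
  by (rule that[of "\<chi> i. Re (v $ i)" "\<chi> i. Im (v $ i)"]) (simp add: cvec_def vec_eq_iff)

lemma cvec_eq_iff [simp]: "cvec x y = cvec x' y' \<longleftrightarrow> x = x' \<and> y = y'"
  by (auto simp: cvec_def vec_eq_iff)

lemma cvec_eq_0_iff [simp]: "cvec x y = 0 \<longleftrightarrow> x = 0 \<and> y = 0"
  by (auto simp: cvec_def vec_eq_iff complex_eq_iff)

lemma cvec_add: "cvec x y + cvec x' y' = cvec (x + x') (y + y')"
  by (simp add: cvec_def vec_eq_iff complex_eq_iff)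

lemma cvec_diff: "cvec x y - cvec x' y' = cvec (x - x') (y - y')"
  by (simp add: cvec_def vec_eq_iff complex_eq_iff)

lemma cvec_scale: "l *s cvec x y = cvec (Re l *\<^sub>R x - Im l *\<^sub>R y) (Im l *\<^sub>R x + Re l *\<^sub>R y)"
  by (simp add: cvec_def vec_eq_iff complex_eq_iff)

lemma cmat_mult_cvec: "cmat M *v cvec x y = cvec (M *v x) (M *v y)"
  by (simp add: cvec_def vec_eq_iff complex_eq_iff matrix_vector_mult_def map_matrix_def)

lemma norm_cvec: "(norm (cvec x y))\<^sup>2 = (norm x)\<^sup>2 + (norm y)\<^sup>2"
  by (simp add: power2_norm_eq_inner inner_vec_def cvec_def inner_complex_def sum.distrib)

lemma inner_cvec: "cvec x y \<bullet> cvec x y = x \<bullet> x + y \<bullet> y"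
  using norm_cvec[of x y] by (simp only: power2_norm_eq_inner)

text \<open>A real invariant subspace contains the real and imaginary parts of a complex eigenvector.\<close>

lemma real_invariant_subspace_eigenpair:
  fixes D :: "real ^ 'n ^ 'n"
  assumes V: "subspace V" "V \<noteq> {0}" and D: "\<And>x. x \<in> V \<Longrightarrow> D *v x \<in> V"
  obtains a b x y where "x \<in> V" "y \<in> V" "x \<noteq> 0 \<or> y \<noteq> 0"
    "D *v x = a *\<^sub>R x - b *\<^sub>R y" "D *v y = b *\<^sub>R x + a *\<^sub>R y"
proof -
  define W where "W = {cvec x y | x y. x \<in> V \<and> y \<in> V}"
  obtain x0 where x0: "x0 \<in> V" "x0 \<noteq> 0" using V subspace_0 by blast
  have "cvec x0 0 \<in> W" using x0 V by (auto simp: W_def subspace_0)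
  moreover have "cvec x0 0 \<noteq> 0" using x0 by simp
  moreover have "u + v \<in> W" if "u \<in> W" "v \<in> W" for u v
    using that V by (auto simp: W_def cvec_add subspace_add)
  moreover have "l *s u \<in> W" if "u \<in> W" for l u
    using that V by (auto simp: W_def cvec_scale intro!: subspace_add subspace_diff subspace_scale)
  moreover have "cmat D *v u \<in> W" if "u \<in> W" for u
    using that D by (auto simp: W_def cmat_mult_cvec)
  ultimately obtain l u where u: "u \<in> W" "u \<noteq> 0" "cmat D *v u = l *s u"
    using invariant_subspace_eigenvector[of "cvec x0 0" W] by metis
  then obtain x y where "u = cvec x y" "x \<in> V" "y \<in> V" by (auto simp: W_def)
  then show thesis
    using that[of x y "Re l" "Im l"] u by (simp add: cmat_mult_cvec cvec_scale)
qed

lemma eigenvalue_cmat_iff: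
  "l \<in> eigenvalues (cmat D) \<longleftrightarrow> (\<exists>x y. (x \<noteq> 0 \<or> y \<noteq> 0) \<and>
     D *v x = Re l *\<^sub>R x - Im l *\<^sub>R y \<and> D *v y = Im l *\<^sub>R x + Re l *\<^sub>R y)"
proof
  assume "l \<in> eigenvalues (cmat D)"
  then obtain v where v: "v \<noteq> 0" "cmat D *v v = l *s v" by (auto simp: eigenvalues_def)
  obtain x y where "v = cvec x y" using cvec_cases .
  with v show "\<exists>x y. (x \<noteq> 0 \<or> y \<noteq> 0) \<and>
     D *v x = Re l *\<^sub>R x - Im l *\<^sub>R y \<and> D *v y = Im l *\<^sub>R x + Re l *\<^sub>R y"
    by (auto simp: cmat_mult_cvec cvec_scale)
next
  assume "\<exists>x y. (x \<noteq> 0 \<or> y \<noteq> 0) \<and>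
     D *v x = Re l *\<^sub>R x - Im l *\<^sub>R y \<and> D *v y = Im l *\<^sub>R x + Re l *\<^sub>R y"
  then obtain x y where "x \<noteq> 0 \<or> y \<noteq> 0" "D *v x = Re l *\<^sub>R x - Im l *\<^sub>R y"
    "D *v y = Im l *\<^sub>R x + Re l *\<^sub>R y" by blast
  then show "l \<in> eigenvalues (cmat D)"
    unfolding eigenvalues_def by (auto intro!: exI[of _ "cvec x y"] simp: cmat_mult_cvec cvec_scale)
qed

section \<open>An alternative for Lyapunov inequalities\<close>

lemma real_affine_nonneg_imp:
  assumes "\<And>t. t \<ge> 0 \<Longrightarrow> 0 \<le> t * a + c" shows "0 \<le> (a :: real)"
proof (rule ccontr)
  assume "\<not> 0 \<le> a"
  then have "(\<bar>c\<bar> + 1) / (- a) * a = - (\<bar>c\<bar> + 1)" "(\<bar>c\<bar> + 1) / (- a) \<ge> 0"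
    by (simp_all add: field_simps)
  then show False
    using assms[of "(\<bar>c\<bar> + 1) / (- a)"] by linarith
qed

lemma pos_def_convex: "convex {M. pos_def M}"
  unfolding convex_def pos_def_def
proof (clarsimp simp: transpose_simps matrix_vector_left_simps inner_add_right)
  fix M N :: "real ^ 'n ^ 'n" and u v :: real and x :: "real ^ 'n"
  assume "\<forall>x. x \<noteq> 0 \<longrightarrow> 0 < x \<bullet> (M *v x)" "\<forall>x. x \<noteq> 0 \<longrightarrow> 0 < x \<bullet> (N *v x)" "0 \<le> u" "0 \<le> v" "u + v = 1" "x \<noteq> 0"
  then show "0 < u * (x \<bullet> (M *v x)) + v * (x \<bullet> (N *v x))"
    by (cases "u = 0") (auto intro!: add_pos_nonneg simp: order_less_imp_le)
qed

lemma symmetric_range_subset: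
  fixes Z W :: "real ^ 'n ^ 'n"
  assumes sym: "transpose Z = Z" "transpose W = W" and ker: "\<And>x. Z *v x = 0 \<Longrightarrow> W *v x = 0"
  shows "range ((*v) W) \<subseteq> range ((*v) Z)"
proof safe
  fix u
  have sub: "subspace (range ((*v) Z))"
    by (intro linear_subspace_image) auto
  obtain y r where y: "y \<in> range ((*v) Z)" and r: "\<And>w. w \<in> range ((*v) Z) \<Longrightarrow> orthogonal r w"
    and W: "W *v u = y + r"
    using orthogonal_subspace_decomp_exists[of "range ((*v) Z)" "W *v u"] sub
    by (metis span_eq_iff)
  have "(Z *v r) \<bullet> (Z *v r) = r \<bullet> (Z *v (Z *v r))"
    by (simp add: inner_symmetric_matrix[OF sym(1)])
  also have "\<dots> = 0" using r by (auto simp: orthogonal_def)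
  finally have "W *v r = 0" using ker by simp
  then have "r \<bullet> (W *v u) = 0" by (simp add: inner_symmetric_matrix[OF sym(2)])
  moreover have "r \<bullet> y = 0" using r y by (auto simp: orthogonal_def)
  ultimately have "r = 0" unfolding W by (simp add: inner_add_right)
  then show "W *v u \<in> range ((*v) Z)" using W y by simp
qed

text \<open>A theorem of the alternative.  The first case makes the strict inequalities solvable to first order at \<open>P\<close>.  The second case is what separation of the convex cone of pairs of positive
  definite matrices from the affine space of pairs \<open>(P + H, - (N + D\<^sup>T H + H D))\<close> produces: the
  separating functional is a pair \<open>(Z\<^sub>1, Z\<^sub>2)\<close> of positive semidefinite matrices with
  \<open>Z\<^sub>1 = D Z\<^sub>2 + Z\<^sub>2 D\<^sup>T\<close>, and the range of \<open>Z\<^sub>2\<close> is invariant under \<open>D\<close>.\<close>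

lemma Lyapunov_alternative:
  fixes P N D :: "real ^ 'n ^ 'n"
  assumes P: "pos_semidef P" and N: "pos_semidef (- N)"
  obtains
    (step) H where "transpose H = H" "pos_def (P + H)" "pos_def (- (N + transpose D ** H + H ** D))"
  | (eigenpair) a b x y where "x \<noteq> 0 \<or> y \<noteq> 0"
      "D *v x = a *\<^sub>R x - b *\<^sub>R y" "D *v y = b *\<^sub>R x + a *\<^sub>R y"
      "x \<bullet> (N *v x) = 0" "y \<bullet> (N *v y) = 0" "0 \<le> a" "pos_def P \<Longrightarrow> a = 0"
proof (cases "\<exists>H. transpose H = H \<and> pos_def (P + H) \<and> pos_def (- (N + transpose D ** H + H ** D))")
  case True
  then show thesis using step by blast
next
  case infeasible: False
  define L where "L H = transpose D ** H + H ** D" for H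
  have L: "linear L"
    unfolding L_def by (intro linearI) (auto simp: matrix_mult_bilinear_simps scaleR_add_right)
  define S where "S = {(X - P - H, Y + N + L H) | X Y H. pos_def X \<and> pos_def Y \<and> transpose H = H}"
  have symL: "transpose (L H) = L H" if "transpose H = H" for H
    using that by (simp add: L_def transpose_simps matrix_transpose_mul add.commute)
  have "convex S"
    unfolding convex_def
  proof safe
    fix A1 A2 B1 B2 and u v :: real
    assume uv: "0 \<le> u" "0 \<le> v" "u + v = 1" and "(A1, A2) \<in> S" "(B1, B2) \<in> S"
    then obtain X Y H X' Y' H' where
      1: "A1 = X - P - H" "A2 = Y + N + L H" "pos_def X" "pos_def Y" "transpose H = H" and
      2: "B1 = X' - P - H'" "B2 = Y' + N + L H'" "pos_def X'" "pos_def Y'" "transpose H' = H'"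
      unfolding S_def by blast
    have "pos_def (u *\<^sub>R X + v *\<^sub>R X')" "pos_def (u *\<^sub>R Y + v *\<^sub>R Y')"
      using pos_def_convex uv 1 2 unfolding convex_def by auto
    moreover have "u *\<^sub>R P + v *\<^sub>R P = P" "u *\<^sub>R N + v *\<^sub>R N = N"
      using uv by (simp_all flip: scaleR_add_left)
    then have "u *\<^sub>R (A1, A2) + v *\<^sub>R (B1, B2) =
      ((u *\<^sub>R X + v *\<^sub>R X') - P - (u *\<^sub>R H + v *\<^sub>R H'),
       (u *\<^sub>R Y + v *\<^sub>R Y') + N + L (u *\<^sub>R H + v *\<^sub>R H'))"
      unfolding 1 2 linear_add[OF L] linear_scale[OF L] by (simp add: algebra_simps)
    moreover have "transpose (u *\<^sub>R H + v *\<^sub>R H') = u *\<^sub>R H + v *\<^sub>R H'"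
      using 1 2 by (simp add: transpose_simps)
    ultimately show "u *\<^sub>R (A1, A2) + v *\<^sub>R (B1, B2) \<in> S"
      unfolding S_def by blast
  qed
  moreover have "S \<noteq> {}"
  proof -
    have "pos_def (mat 1 :: real ^ 'n ^ 'n)" by (simp add: pos_def_def)
    then have "(mat 1 - P - 0, mat 1 + N + L 0) \<in> S"
      unfolding S_def using transpose_simps(4) by blast
    then show ?thesis by blast
  qed
  moreover have "0 \<notin> S"
  proof
    assume "0 \<in> S"
    then obtain X Y H where "X - P - H = 0" "Y + N + L H = 0" "pos_def X" "pos_def Y" "transpose H = H"
      unfolding S_def zero_prod_def mem_Collect_eq prod.inject by metis
    moreover from this have "X = P + H" "Y = - (N + transpose D ** H + H ** D)"
      by (simp_all add: L_def algebra_simps eq_neg_iff_add_eq_0)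
    ultimately show False using infeasible by blast
  qed
  ultimately obtain Z where Z: "Z \<in> span S" "Z \<noteq> 0" "\<And>x. x \<in> S \<Longrightarrow> 0 \<le> Z \<bullet> x"
    using separating_hyperplane_set_0_inspan by blast
  obtain Z1 Z2 where Z12: "Z = (Z1, Z2)" by force
  have "S \<subseteq> {(A, B). transpose A = A \<and> transpose B = B}"
    using P N by (auto simp: S_def pos_def_def pos_semidef_def transpose_simps symL)
  moreover have "subspace {(A :: real ^ 'n ^ 'n, B :: real ^ 'n ^ 'n). transpose A = A \<and> transpose B = B}"
    by (auto simp: subspace_def transpose_simps zero_prod_def)
  ultimately have "span S \<subseteq> {(A, B). transpose A = A \<and> transpose B = B}"
    by (rule span_minimal)
  with Z(1) Z12 have symZ: "transpose Z1 = Z1" "transpose Z2 = Z2" by auto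
  define c where "c = Z2 \<bullet> N - Z1 \<bullet> P"
  \<comment> \<open>The separation inequality, extended to semidefinite \<open>X\<close> and \<open>Y\<close> by continuity.\<close>
  have main: "0 \<le> Z1 \<bullet> X + Z2 \<bullet> Y + (Z2 \<bullet> L H - Z1 \<bullet> H) + c"
    if X: "pos_semidef X" and Y: "pos_semidef Y" and H: "transpose H = H" for X Y H
  proof -
    have "0 \<le> Z1 \<bullet> (X + e *\<^sub>R mat 1) + Z2 \<bullet> (Y + e *\<^sub>R mat 1) + (Z2 \<bullet> L H - Z1 \<bullet> H) + c" if "e > 0" for e
    proof -
      have "(X + e *\<^sub>R mat 1 - P - H, Y + e *\<^sub>R mat 1 + N + L H) \<in> S"
        using pos_def_add_scaleR_id that X Y H unfolding S_def by blast
      from Z(3)[OF this] show ?thesis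
        by (simp add: Z12 c_def inner_diff_right inner_add_right algebra_simps)
    qed
    moreover have "((\<lambda>e. Z1 \<bullet> (X + e *\<^sub>R mat 1) + Z2 \<bullet> (Y + e *\<^sub>R mat 1) + (Z2 \<bullet> L H - Z1 \<bullet> H) + c)
        \<longlongrightarrow> Z1 \<bullet> (X + 0 *\<^sub>R mat 1) + Z2 \<bullet> (Y + 0 *\<^sub>R mat 1) + (Z2 \<bullet> L H - Z1 \<bullet> H) + c) (at_right 0)"
      by (intro tendsto_intros)
    ultimately have "0 \<le> Z1 \<bullet> (X + 0 *\<^sub>R mat 1) + Z2 \<bullet> (Y + 0 *\<^sub>R mat 1) + (Z2 \<bullet> L H - Z1 \<bullet> H) + c"
      by (intro tendsto_lowerbound[where F = "at_right (0::real)"])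
        (auto intro!: eventually_at_rightI[of 0 1])
    then show ?thesis by simp
  qed
  have ps0: "pos_semidef (0 :: real ^ 'n ^ 'n)" by (simp add: pos_semidef_def transpose_simps)
  have scale: "pos_semidef (t *\<^sub>R M)" if "pos_semidef M" "t \<ge> 0" for t and M :: "real ^ 'n ^ 'n"
    using that by (simp add: pos_semidef_def transpose_simps matrix_vector_scaleR_left)
  have Z1X: "0 \<le> Z1 \<bullet> X" if "pos_semidef X" for X
  proof (rule real_affine_nonneg_imp)
    show "0 \<le> t * (Z1 \<bullet> X) + c" if t: "t \<ge> 0" for t
      using main[OF scale[OF \<open>pos_semidef X\<close> t] ps0, of 0] by (simp add: linear_0[OF L] transpose_simps)
  qed
  have Z2X: "0 \<le> Z2 \<bullet> X" if "pos_semidef X" for X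
  proof (rule real_affine_nonneg_imp)
    show "0 \<le> t * (Z2 \<bullet> X) + c" if t: "t \<ge> 0" for t
      using main[OF ps0 scale[OF \<open>pos_semidef X\<close> t], of 0] by (simp add: linear_0[OF L] transpose_simps)
  qed
  have psd1: "pos_semidef Z1"
    unfolding pos_semidef_def
  proof safe
    show "0 \<le> x \<bullet> (Z1 *v x)" for x
      using outer_product[of x] Z1X by (metis inner_commute)
  qed (use symZ in auto)
  have psd2: "pos_semidef Z2"
    unfolding pos_semidef_def
  proof safe
    show "0 \<le> x \<bullet> (Z2 *v x)" for x
      using outer_product[of x] Z2X by (metis inner_commute)
  qed (use symZ in auto)
  have "0 \<le> c" using main[OF ps0 ps0, of 0] by (simp add: linear_0[OF L] transpose_simps)
  moreover have "0 \<le> Z1 \<bullet> P" "0 \<le> Z2 \<bullet> (- N)" using Z1X[OF P] Z2X[OF N] by auto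
  ultimately have Z1P: "Z1 \<bullet> P = 0" and Z2N: "Z2 \<bullet> (- N) = 0"
    by (auto simp: c_def)
  define \<Delta> where "\<Delta> = D ** Z2 + Z2 ** transpose D - Z1"
  have sym\<Delta>: "transpose \<Delta> = \<Delta>"
    using symZ by (simp add: \<Delta>_def transpose_simps matrix_transpose_mul add.commute)
  \<comment> \<open>The functional is bounded below on the subspace of all \<open>H\<close>, hence vanishes on it; \<open>\<Delta>\<close> represents it.\<close>
  have "0 \<le> t * - (\<Delta> \<bullet> \<Delta>) + c" if "t \<ge> 0" for t
  proof -
    have "Z2 \<bullet> (transpose D ** \<Delta>) = (D ** Z2) \<bullet> \<Delta>"
      by (simp add: inner_eq_trace matrix_transpose_mul symZ matrix_mul_assoc)
    moreover have "Z2 \<bullet> (\<Delta> ** D) = (Z2 ** transpose D) \<bullet> \<Delta>"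
      using trace_mul_sym[of "Z2 ** \<Delta>" D]
      by (simp add: inner_eq_trace matrix_transpose_mul symZ matrix_mul_assoc)
    ultimately have "Z2 \<bullet> L \<Delta> = (D ** Z2 + Z2 ** transpose D) \<bullet> \<Delta>"
      by (simp add: L_def inner_add_left inner_add_right)
    then have "Z2 \<bullet> L \<Delta> - Z1 \<bullet> \<Delta> = \<Delta> \<bullet> \<Delta>"
      by (simp only: inner_diff_left[symmetric] \<Delta>_def[symmetric])
    moreover have "Z2 \<bullet> L ((- t) *\<^sub>R \<Delta>) - Z1 \<bullet> ((- t) *\<^sub>R \<Delta>) = - t * (Z2 \<bullet> L \<Delta> - Z1 \<bullet> \<Delta>)"
      unfolding linear_scale[OF L] inner_scaleR_right by (simp only: right_diff_distrib)
    ultimately have "Z2 \<bullet> L ((- t) *\<^sub>R \<Delta>) - Z1 \<bullet> ((- t) *\<^sub>R \<Delta>) = t * - (\<Delta> \<bullet> \<Delta>)"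
      by simp
    then show ?thesis
      using main[OF ps0 ps0, of "(- t) *\<^sub>R \<Delta>"] sym\<Delta> by (simp add: transpose_simps)
  qed
  then have "0 \<le> - (\<Delta> \<bullet> \<Delta>)" by (rule real_affine_nonneg_imp)
  then have "\<Delta> = 0" by (metis inner_eq_zero_iff inner_ge_zero neg_0_le_iff_le order_antisym)
  then have Z1: "Z1 *v u = D *v (Z2 *v u) + Z2 *v (transpose D *v u)" for u
  proof -
    have "Z1 = D ** Z2 + Z2 ** transpose D" using \<open>\<Delta> = 0\<close> by (simp add: \<Delta>_def)
    then show ?thesis
      by (simp add: matrix_vector_mult_add_rdistrib matrix_vector_mul_assoc[symmetric]
          del: transpose_matrix_vector)
  qed
  have "Z2 \<noteq> 0"
  proof
    assume "Z2 = 0"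
    then have "Z1 = 0" using \<open>\<Delta> = 0\<close> by (simp add: \<Delta>_def matrix_mult_bilinear_simps)
    with \<open>Z2 = 0\<close> Z(2) Z12 show False by (simp add: zero_prod_def)
  qed
  \<comment> \<open>The range of \<open>Z2\<close> is \<open>D\<close>-invariant, because \<open>D Z2 = Z1 - Z2 D\<^sup>T\<close> and the range of \<open>Z1\<close> is contained in it.\<close>
  have "range ((*v) Z1) \<subseteq> range ((*v) Z2)"
  proof (rule symmetric_range_subset[OF symZ(2,1)])
    fix x assume x: "Z2 *v x = 0"
    then have "x \<bullet> (Z1 *v x) = 0"
      using Z1[of x] inner_symmetric_matrix[OF symZ(2), of x] by simp
    then show "Z1 *v x = 0" by (rule pos_semidef_kernel[OF psd1])
  qed
  moreover have sub: "subspace (range ((*v) Z2))"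
    by (intro linear_subspace_image) auto
  ultimately have "D *v x \<in> range ((*v) Z2)" if "x \<in> range ((*v) Z2)" for x
  proof -
    obtain u where u: "x = Z2 *v u" using \<open>x \<in> range ((*v) Z2)\<close> by blast
    have "D *v x = Z1 *v u - Z2 *v (transpose D *v u)" using Z1[of u] u by simp
    then show ?thesis
      using \<open>range ((*v) Z1) \<subseteq> range ((*v) Z2)\<close> sub by (auto intro!: subspace_diff)
  qed
  moreover have "range ((*v) Z2) \<noteq> {0}"
    using \<open>Z2 \<noteq> 0\<close> by (metis matrix_eq_0_iff_axis rangeI singletonD)
  ultimately obtain a b x y where xy: "x \<in> range ((*v) Z2)" "y \<in> range ((*v) Z2)" "x \<noteq> 0 \<or> y \<noteq> 0"
    and D: "D *v x = a *\<^sub>R x - b *\<^sub>R y" "D *v y = b *\<^sub>R x + a *\<^sub>R y"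
    using real_invariant_subspace_eigenpair[OF sub] by metis
  obtain p q where p: "x = Z2 *v p" and q: "y = Z2 *v q" using xy by blast
  have form: "u \<bullet> (Z1 *v u) = 2 * (u \<bullet> (D *v (Z2 *v u)))" for u
  proof -
    have "u \<bullet> (Z2 *v (transpose D *v u)) = (transpose D *v u) \<bullet> (Z2 *v u)"
      by (simp only: inner_symmetric_matrix[OF symZ(2)] inner_commute)
    also have "\<dots> = u \<bullet> (D *v (Z2 *v u))" by (simp only: inner_matrix_vector)
    finally show ?thesis unfolding Z1 inner_add_right by simp
  qed
  define s where "s = p \<bullet> (Z2 *v p) + q \<bullet> (Z2 *v q)"
  have "p \<bullet> (Z2 *v p) \<ge> 0" "q \<bullet> (Z2 *v q) \<ge> 0" using psd2 by (auto simp: pos_semidef_def)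
  moreover have "p \<bullet> (Z2 *v p) \<noteq> 0 \<or> q \<bullet> (Z2 *v q) \<noteq> 0"
    using pos_semidef_kernel[OF psd2] xy p q by auto
  ultimately have s: "s > 0" unfolding s_def by linarith
  have "p \<bullet> y = q \<bullet> x"
    using inner_symmetric_matrix[OF symZ(2), of p q] by (simp add: p q inner_commute)
  \<comment> \<open>Twice the real part of \<open>u\<^sup>* D Z2 u\<close> for \<open>u = p + i q\<close>, computed in two ways.\<close>
  then have as: "2 * a * s = p \<bullet> (Z1 *v p) + q \<bullet> (Z1 *v q)"
    unfolding form s_def p[symmetric] q[symmetric] D
    by (simp add: inner_diff_right inner_add_right algebra_simps)
  show thesis
  proof (rule eigenpair[OF xy(3) D])
    have "x \<bullet> ((- N) *v x) = 0" "y \<bullet> ((- N) *v y) = 0"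
      using pos_semidef_inner_0_range[OF psd2 N Z2N] p q by auto
    then show "x \<bullet> (N *v x) = 0" "y \<bullet> (N *v y) = 0" by (simp_all add: matrix_vector_minus_left)
    have "0 \<le> 2 * a * s" unfolding as using psd1 by (simp add: pos_semidef_def)
    then show "0 \<le> a" using s by (simp add: zero_le_mult_iff)
    assume "pos_def P"
    then have "Z1 = 0" using pos_def_inner_0 psd1 Z1P by blast
    then show "a = 0" using as s by simp
  qed
qed

section \<open>The non-strict bounded real lemma\<close>

text \<open>The quadratic form \<open>x \<mapsto> x\<^sup>T (F\<^sup>T P + P F + \<gamma>\<^sup>-\<^sup>1 P B\<^sub>w B\<^sub>w\<^sup>T P + \<tau> \<gamma>\<^sup>-\<^sup>1 G) x\<close> of the Riccati operator.\<close>

definition riccati_form ::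
    "real ^ 'n ^ 'n \<Rightarrow> real ^ 'n ^ 'n \<Rightarrow> real ^ 'n ^ 'n \<Rightarrow> real \<Rightarrow> real \<Rightarrow> real ^ 'n ^ 'n \<Rightarrow> real ^ 'n \<Rightarrow> real"
  where "riccati_form F Bw G \<gamma> \<tau> P x = 2 * ((P *v x) \<bullet> (F *v x)) +
    ((norm (transpose Bw *v (P *v x)))\<^sup>2 + \<tau> * (x \<bullet> (G *v x))) / \<gamma>"

lemma linear_matrix_vector_left: "linear (\<lambda>M. M *v x)" for x :: "real ^ 'q"
  by (rule linearI) (simp_all add: matrix_vector_left_simps)

lemma continuous_on_matrix_vector_left [continuous_intros]:
  "continuous_on U f \<Longrightarrow> continuous_on U (\<lambda>z. f z *v x)" for x :: "real ^ 'q"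
  by (rule bounded_linear.continuous_on[OF linear_matrix_vector_left[unfolded linear_conv_bounded_linear]])

lemma continuous_on_matrix_vector_right [continuous_intros]:
  "continuous_on U f \<Longrightarrow> continuous_on U (\<lambda>z. M *v f z)" for M :: "real ^ 'q ^ 'p"
  by (rule bounded_linear.continuous_on[OF matrix_vector_mul_bounded_linear])

lemma bounded_linear_transpose: "bounded_linear (transpose :: real ^ 'q ^ 'p \<Rightarrow> real ^ 'p ^ 'q)"
  unfolding linear_conv_bounded_linear[symmetric] by (rule linearI) (simp_all add: transpose_simps)

lemmas continuous_on_transpose [continuous_intros] =
  bounded_linear.continuous_on[OF bounded_linear_transpose]

lemma symmetric_norm_le:
  fixes P :: "real ^ 'n ^ 'n"
  assumes "transpose P = P" and bound: "\<And>x. norm (P *v x) \<le> k * norm x"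
  shows "norm P \<le> of_nat CARD('n) * k"
proof -
  have "norm (P $ i) \<le> k" for i
  proof -
    have "P $ i = P *v axis i 1"
      using assms(1) by (metis column_transpose matrix_vector_mult_basis row_def vec_nth_inverse)
    then show ?thesis using bound[of "axis i 1"] by simp
  qed
  then have "(\<Sum>i\<in>UNIV. norm (P $ i)) \<le> of_nat CARD('n) * k"
    using sum_bounded_above[of UNIV "\<lambda>i. norm (P $ i)" k] by simp
  moreover have "norm P \<le> (\<Sum>i\<in>UNIV. norm (P $ i))"
    unfolding norm_vec_def by (rule L2_set_le_sum) simp
  ultimately show ?thesis by linarith
qed

text \<open>Since \<open>B\<^sub>w\<close> is invertible, the quadratic term dominates and solutions of the Riccati inequality
  are bounded.\<close>

lemma riccati_bound:
  fixes F Bw G :: "real ^ 'n ^ 'n"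
  assumes inv: "invertible Bw" and G: "pos_semidef G" and \<gamma>: "\<gamma> > 0"
  obtains k where "\<And>\<tau> P x. \<tau> \<ge> 0 \<Longrightarrow> riccati_form F Bw G \<gamma> \<tau> P x \<le> 0 \<Longrightarrow> norm (P *v x) \<le> k * norm x"
proof -
  obtain c where c: "c > 0" "\<And>x. norm x \<le> c * norm (transpose Bw *v x)"
    using invertible_imp_norm_bound_below[of "transpose Bw"] transpose_invertible[OF inv] by blast
  obtain f where f: "f > 0" "\<And>x. norm (F *v x) \<le> f * norm x"
    using matrix_vector_norm_bound by blast
  show thesis
  proof
    fix \<tau> P and x :: "real ^ 'n"
    assume \<tau>: "\<tau> \<ge> 0" and r: "riccati_form F Bw G \<gamma> \<tau> P x \<le> 0"
    define z where "z = P *v x"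
    have "0 \<le> \<tau> * (x \<bullet> (G *v x))" using \<tau> G by (simp add: pos_semidef_def)
    then have "(norm (transpose Bw *v z))\<^sup>2 \<le> - (2 * \<gamma>) * (z \<bullet> (F *v x))"
      using r \<gamma> by (simp add: riccati_form_def z_def field_simps)
    also have "\<dots> \<le> 2 * \<gamma> * (norm z * (f * norm x))"
    proof -
      have "- (z \<bullet> (F *v x)) \<le> norm z * norm (F *v x)"
        using Cauchy_Schwarz_ineq2[of z "F *v x"] by linarith
      also have "\<dots> \<le> norm z * (f * norm x)" by (intro mult_left_mono f) auto
      finally have le: "- (z \<bullet> (F *v x)) \<le> norm z * (f * norm x)" .
      have "0 \<le> 2 * \<gamma>" using \<gamma> by simp
      from mult_left_mono[OF le this] show ?thesis by (simp only: mult_minus_left mult_minus_right)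
    qed
    finally have *: "(norm (transpose Bw *v z))\<^sup>2 \<le> 2 * \<gamma> * (norm z * (f * norm x))" .
    have "norm z * norm z \<le> (c * norm (transpose Bw *v z))\<^sup>2"
      unfolding power2_eq_square using c by (intro mult_mono) auto
    also have "\<dots> \<le> c\<^sup>2 * (2 * \<gamma> * (norm z * (f * norm x)))"
      unfolding power_mult_distrib by (intro mult_left_mono *) auto
    also have "\<dots> = norm z * (c\<^sup>2 * 2 * \<gamma> * f * norm x)" by (simp add: mult_ac)
    finally show "norm (P *v x) \<le> (c\<^sup>2 * 2 * \<gamma> * f) * norm x"
      unfolding z_def[symmetric] using \<gamma> f by (cases "z = 0") (auto simp: mult_le_cancel_left)
  qed
qed

lemma riccati_form_pos_def:
  assumes G: "pos_def G" and \<gamma>: "\<gamma> > 0" and \<tau>: "\<tau> > 0"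
    and P: "pos_semidef P" and r: "\<And>x. riccati_form F Bw G \<gamma> \<tau> P x \<le> 0"
  shows "pos_def P"
  unfolding pos_def_def
proof safe
  fix x :: "real ^ 'a" assume "x \<noteq> 0"
  have "P *v x \<noteq> 0"
  proof
    assume "P *v x = 0"
    then have "\<tau> * (x \<bullet> (G *v x)) / \<gamma> \<le> 0" using r[of x] by (simp add: riccati_form_def)
    moreover have "x \<bullet> (G *v x) > 0" using G \<open>x \<noteq> 0\<close> by (simp add: pos_def_def)
    ultimately show False using \<tau> \<gamma> by (simp add: divide_le_0_iff mult_le_0_iff)
  qed
  then show "0 < x \<bullet> (P *v x)"
    using P pos_semidef_kernel[OF P, of x] by (auto simp: pos_semidef_def order_less_le)
qed (use P in \<open>auto simp: pos_semidef_def\<close>)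

text \<open>The perturbation of a solution by \<open>\<epsilon> H\<close>, to first order, is governed by the closed-loop matrix
  \<open>D = F + \<gamma>\<^sup>-\<^sup>1 B\<^sub>w B\<^sub>w\<^sup>T P\<close>.\<close>

lemma riccati_form_perturb:
  assumes \<gamma>: "\<gamma> > 0" and D: "D = F + (1 / \<gamma>) *\<^sub>R (Bw ** (transpose Bw ** P))"
  shows "riccati_form F Bw G \<gamma> \<tau>' (P + \<epsilon> *\<^sub>R H) x = riccati_form F Bw G \<gamma> \<tau> P x
    + \<epsilon> * (2 * ((H *v x) \<bullet> (D *v x))) + \<epsilon>\<^sup>2 * (norm (transpose Bw *v (H *v x)))\<^sup>2 / \<gamma>
    + (\<tau>' - \<tau>) * (x \<bullet> (G *v x)) / \<gamma>"
proof -
  define h p where "h = transpose Bw *v (H *v x)" and "p = transpose Bw *v (P *v x)"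
  have HD: "2 * ((H *v x) \<bullet> (D *v x)) = 2 * ((H *v x) \<bullet> (F *v x)) + 2 * (h \<bullet> p) / \<gamma>"
    unfolding D h_def p_def
    by (simp add: matrix_vector_left_simps inner_add_right matrix_vector_mul_assoc[symmetric]
        inner_matrix_vector[of _ Bw] del: transpose_matrix_vector)
  have lin: "transpose Bw *v ((P + \<epsilon> *\<^sub>R H) *v x) = p + \<epsilon> *\<^sub>R h"
    by (simp add: matrix_vector_left_simps h_def p_def matrix_vector_right_distrib matrix_vector_mult_scaleR
        del: transpose_matrix_vector)
  have sq: "(norm (p + \<epsilon> *\<^sub>R h))\<^sup>2 = (norm p)\<^sup>2 + 2 * \<epsilon> * (h \<bullet> p) + \<epsilon>\<^sup>2 * (norm h)\<^sup>2"
    unfolding power2_norm_eq_inner by (simp add: inner_add algebra_simps power2_eq_square inner_commute)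
  show ?thesis
    unfolding riccati_form_def h_def[symmetric] p_def[symmetric] lin sq HD
    using \<gamma> by (simp add: matrix_vector_left_simps inner_add_left field_simps)
qed

text \<open>An imaginary eigenvalue \<open>i b\<close> of \<open>D\<close> with an eigenvector \<open>x + i y\<close> on which the Riccati form vanishes contradicts the
  frequency-domain inequality at \<open>\<omega> = b\<close>: with the disturbance \<open>\<gamma>\<^sup>-\<^sup>1 B\<^sub>w\<^sup>T P (x + i y)\<close> that inequality holds with
  equality for the weight \<open>\<tau> G\<close>, so it fails for \<open>G\<close>.\<close>

lemma riccati_no_imaginary_eigenpair:
  fixes F Bw G P :: "real ^ 'n ^ 'n"
  assumes \<gamma>: "\<gamma> > 0" and G: "pos_def G" and \<tau>: "\<tau> < 1" and symP: "transpose P = P"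
    and freq: "\<And>\<omega> x y p q. Bw *v p = - \<omega> *\<^sub>R y - F *v x \<Longrightarrow> Bw *v q = \<omega> *\<^sub>R x - F *v y \<Longrightarrow>
      x \<bullet> (G *v x) + y \<bullet> (G *v y) \<le> \<gamma>\<^sup>2 * (p \<bullet> p + q \<bullet> q)"
    and D: "D = F + (1 / \<gamma>) *\<^sub>R (Bw ** (transpose Bw ** P))"
    and eig: "D *v x = - b *\<^sub>R y" "D *v y = b *\<^sub>R x"
    and 0: "riccati_form F Bw G \<gamma> \<tau> P x = 0" "riccati_form F Bw G \<gamma> \<tau> P y = 0"
  shows "x = 0 \<and> y = 0"
proof (rule ccontr)
  assume nz: "\<not> (x = 0 \<and> y = 0)"
  define p q where "p = (1 / \<gamma>) *\<^sub>R (transpose Bw *v (P *v x))" and "q = (1 / \<gamma>) *\<^sub>R (transpose Bw *v (P *v y))"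
  have Dv: "D *v v = F *v v + Bw *v ((1 / \<gamma>) *\<^sub>R (transpose Bw *v (P *v v)))" for v
    unfolding D
    by (simp add: matrix_vector_left_simps matrix_vector_mul_assoc[symmetric] matrix_vector_mult_scaleR
        del: transpose_matrix_vector)
  have p: "Bw *v p = - b *\<^sub>R y - F *v x" and q: "Bw *v q = b *\<^sub>R x - F *v y"
    using Dv[of x] Dv[of y] eig by (simp_all add: p_def q_def algebra_simps)
  define g where "g = x \<bullet> (G *v x) + y \<bullet> (G *v y)"
  have "g \<le> \<gamma>\<^sup>2 * (p \<bullet> p + q \<bullet> q)" unfolding g_def by (rule freq[OF p q])
  moreover have "g > 0"
    using nz G unfolding g_def pos_def_def by (metis add.commute add.right_neutral add_strict_mono inner_zero_left)
  moreover have "\<gamma>\<^sup>2 * (p \<bullet> p + q \<bullet> q) = \<tau> * g"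
  proof -
    have "(norm v)\<^sup>2 = \<gamma>\<^sup>2 * (((1 / \<gamma>) *\<^sub>R v) \<bullet> ((1 / \<gamma>) *\<^sub>R v))" for v :: "real ^ 'n"
      using \<gamma> by (simp add: dot_square_norm field_simps power2_eq_square)
    then have n: "(norm (transpose Bw *v (P *v x)))\<^sup>2 = \<gamma>\<^sup>2 * (p \<bullet> p)"
      "(norm (transpose Bw *v (P *v y)))\<^sup>2 = \<gamma>\<^sup>2 * (q \<bullet> q)"
      unfolding p_def q_def by blast+
    have F: "F *v x = - b *\<^sub>R y - Bw *v p" "F *v y = b *\<^sub>R x - Bw *v q"
      using p q by (simp_all add: algebra_simps)
    have B: "(P *v x) \<bullet> (Bw *v p) = \<gamma> * (p \<bullet> p)" "(P *v y) \<bullet> (Bw *v q) = \<gamma> * (q \<bullet> q)"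
      unfolding inner_matrix_vector[of _ Bw] using \<gamma> by (simp_all add: p_def q_def)
    have "(P *v x) \<bullet> y = (P *v y) \<bullet> x"
      using inner_symmetric_matrix[OF symP, of x y] by (simp add: inner_commute)
    then have sum: "(P *v x) \<bullet> (F *v x) + (P *v y) \<bullet> (F *v y) = - \<gamma> * (p \<bullet> p) - \<gamma> * (q \<bullet> q)"
      unfolding F inner_diff_right B by simp
    have "2 * ((P *v x) \<bullet> (F *v x) + (P *v y) \<bullet> (F *v y)) * \<gamma>
        + (\<gamma>\<^sup>2 * (p \<bullet> p) + \<tau> * (x \<bullet> (G *v x))) + (\<gamma>\<^sup>2 * (q \<bullet> q) + \<tau> * (y \<bullet> (G *v y))) = 0"
      using 0 \<gamma> unfolding riccati_form_def n by (simp add: field_simps)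
    then show ?thesis unfolding sum by (simp add: g_def algebra_simps power2_eq_square)
  qed
  ultimately have "g \<le> \<tau> * g" "g > 0" by auto
  then show False using \<tau> by (simp add: mult_le_cancel_right1)
qed

text \<open>The non-strict bounded real lemma for an invertible input matrix.  The parameter \<open>\<tau>\<close> scales the
  output weight \<open>G\<close>; the set of \<open>\<tau>\<close> for which the Riccati inequality is solvable contains \<open>0\<close>, is
  closed by compactness, and no \<open>\<tau> < 1\<close> is its maximum.\<close>

lemma bounded_real_riccati:
  fixes F Bw G :: "real ^ 'n ^ 'n"
  assumes inv: "invertible Bw" and G: "pos_def G" and \<gamma>: "\<gamma> > 0"
    and Hurwitz: "\<And>l. l \<in> eigenvalues (cmat F) \<Longrightarrow> Re l < 0"
    and freq: "\<And>\<omega> x y p q. Bw *v p = - \<omega> *\<^sub>R y - F *v x \<Longrightarrow> Bw *v q = \<omega> *\<^sub>R x - F *v y \<Longrightarrow>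
      x \<bullet> (G *v x) + y \<bullet> (G *v y) \<le> \<gamma>\<^sup>2 * (p \<bullet> p + q \<bullet> q)"
  obtains P where "pos_def P" "\<And>x. riccati_form F Bw G \<gamma> 1 P x \<le> 0"
proof -
  define r where "r = riccati_form F Bw G \<gamma>"
  define T where "T = {z :: real \<times> (real ^ 'n ^ 'n). 0 \<le> fst z \<and> fst z \<le> 1 \<and> transpose (snd z) = snd z \<and>
    (\<forall>x. 0 \<le> x \<bullet> (snd z *v x)) \<and> (\<forall>x. r (fst z) (snd z) x \<le> 0)}"
  have T_iff: "(\<tau>, P) \<in> T \<longleftrightarrow> 0 \<le> \<tau> \<and> \<tau> \<le> 1 \<and> pos_semidef P \<and> (\<forall>x. r \<tau> P x \<le> 0)" for \<tau> P
    by (auto simp: T_def pos_semidef_def)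
  have "closed T"
    unfolding T_def r_def riccati_form_def
    by (intro closed_Collect_conj closed_Collect_all closed_Collect_le closed_Collect_eq
        continuous_intros) (use \<gamma> in auto)
  obtain k where k: "\<And>\<tau> P x. \<tau> \<ge> 0 \<Longrightarrow> r \<tau> P x \<le> 0 \<Longrightarrow> norm (P *v x) \<le> k * norm x"
    using riccati_bound[OF inv pos_def_imp_pos_semidef[OF G] \<gamma>] unfolding r_def by blast
  have "norm z \<le> 1 + of_nat CARD('n) * k" if z: "z \<in> T" for z
  proof -
    have "norm (snd z) \<le> of_nat CARD('n) * k"
      using z k by (intro symmetric_norm_le) (auto simp: T_def)
    moreover have "norm (fst z) \<le> 1" using z by (auto simp: T_def)
    ultimately show ?thesis using norm_Pair_le[of "fst z" "snd z"] by simp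
  qed
  then have "bounded T"
    unfolding bounded_iff by blast
  with \<open>closed T\<close> have "compact T"
    by (simp add: compact_eq_bounded_closed)
  moreover have "(0, 0) \<in> T"
    by (simp add: T_iff pos_semidef_def transpose_simps r_def riccati_form_def)
  ultimately obtain z where z: "z \<in> T" "\<And>z'. z' \<in> T \<Longrightarrow> fst z' \<le> fst z"
    using continuous_attains_sup[of T fst, OF _ _ continuous_on_fst[OF continuous_on_id]] by blast
  obtain \<tau> P1 where z1: "z = (\<tau>, P1)" by force
  have \<tau>: "0 \<le> \<tau>" "\<tau> \<le> 1" and P1: "pos_semidef P1" "\<And>x. r \<tau> P1 x \<le> 0"
    using z(1) by (auto simp: z1 T_iff)
  have "\<not> \<tau> < 1"
  proof
    assume "\<tau> < 1"
    \<comment> \<open>For \<open>\<tau> = 0\<close> the solution \<open>0\<close> is taken, so that \<open>D = F\<close> below.\<close>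
    define P where "P = (if \<tau> = 0 then 0 else P1)"
    have r: "r \<tau> P x \<le> 0" for x
    proof (cases "\<tau> = 0")
      case True
      then show ?thesis by (simp add: P_def r_def riccati_form_def)
    next
      case False
      then show ?thesis using P1(2)[of x] by (simp add: P_def)
    qed
    have psd: "pos_semidef P"
      using P1(1) by (cases "\<tau> = 0") (simp_all add: P_def pos_semidef_def transpose_simps)
    note P = psd r
    have Pdef: "pos_def P" if "\<tau> \<noteq> 0"
    proof (rule riccati_form_pos_def[OF G \<gamma> _ P(1)])
      show "riccati_form F Bw G \<gamma> \<tau> P x \<le> 0" for x
        using P(2)[of x] by (simp only: r_def)
    qed (use that \<tau> in simp)
    define D where "D = F + (1 / \<gamma>) *\<^sub>R (Bw ** (transpose Bw ** P))"
    define N where "N = transpose F ** P + P ** F + (1 / \<gamma>) *\<^sub>R (P ** Bw ** (transpose Bw ** P)) + (\<tau> / \<gamma>) *\<^sub>R G"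
    have symP: "transpose P = P" and symG: "transpose G = G"
      using P G by (auto simp: pos_semidef_def pos_def_def)
    have N: "x \<bullet> (N *v x) = r \<tau> P x" for x
    proof -
      have "x \<bullet> (transpose F *v (P *v x)) = (P *v x) \<bullet> (F *v x)"
        by (metis inner_matrix_vector inner_commute transpose_transpose)
      moreover have "x \<bullet> (P *v (F *v x)) = (P *v x) \<bullet> (F *v x)"
        by (rule inner_symmetric_matrix[OF symP])
      moreover have "x \<bullet> (P *v (Bw *v (transpose Bw *v (P *v x)))) = (norm (transpose Bw *v (P *v x)))\<^sup>2"
        by (simp only: inner_symmetric_matrix[OF symP] inner_matrix_vector[of _ Bw] power2_norm_eq_inner)
      ultimately show ?thesis
        unfolding N_def r_def riccati_form_def matrix_vector_left_simps matrix_vector_mul_assoc[symmetric]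
        by (simp add: inner_add_right add_divide_distrib del: transpose_matrix_vector)
    qed
    have "pos_semidef (- N)"
      unfolding pos_semidef_def
    proof safe
      show "transpose (- N) = - N"
        by (simp add: N_def transpose_simps matrix_transpose_mul symP symG matrix_mul_assoc)
      show "0 \<le> x \<bullet> ((- N) *v x)" for x using N[of x] P(2)[of x] by (simp add: matrix_vector_minus_left)
    qed
    with P(1) show False
    proof (cases rule: Lyapunov_alternative[where D = D])
      case (step H)
      have HD: "x \<bullet> ((transpose D ** H + H ** D) *v x) = 2 * ((H *v x) \<bullet> (D *v x))" for x
      proof -
        have "x \<bullet> (transpose D *v (H *v x)) = (H *v x) \<bullet> (D *v x)"
          by (metis inner_matrix_vector inner_commute transpose_transpose)
        moreover have "x \<bullet> (H *v (D *v x)) = (H *v x) \<bullet> (D *v x)"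
          by (rule inner_symmetric_matrix[OF step(1)])
        ultimately show ?thesis
          unfolding matrix_vector_left_simps matrix_vector_mul_assoc[symmetric] inner_add_right by simp
      qed
      obtain \<delta> where \<delta>: "\<delta> > 0" "\<And>x. \<delta> * (x \<bullet> x) \<le> x \<bullet> ((- (N + transpose D ** H + H ** D)) *v x)"
        using pos_def_coercive[OF step(3)] by blast
      have \<delta>': "r \<tau> P x + 2 * ((H *v x) \<bullet> (D *v x)) \<le> - \<delta> * (x \<bullet> x)" for x
      proof -
        have "x \<bullet> ((- (N + transpose D ** H + H ** D)) *v x)
            = - (x \<bullet> (N *v x) + x \<bullet> ((transpose D ** H + H ** D) *v x))"
          by (simp only: matrix_vector_minus_left add.assoc matrix_vector_mult_add_rdistrib inner_minus_right inner_add_right)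
        then show ?thesis using \<delta>(2)[of x] unfolding HD N by linarith
      qed
      obtain m where m: "m > 0" "\<And>x. (norm (transpose Bw *v (H *v x)))\<^sup>2 \<le> m * (x \<bullet> x)"
      proof -
        obtain c where c: "c > 0" "\<And>x. norm ((transpose Bw ** H) *v x) \<le> c * norm x"
          using matrix_vector_norm_bound by blast
        have "(norm (transpose Bw *v (H *v x)))\<^sup>2 \<le> c\<^sup>2 * (x \<bullet> x)" for x
          using power_mono[OF c(2)[of x], of 2]
          by (simp add: matrix_vector_mul_assoc[symmetric] power_mult_distrib power2_norm_eq_inner
              del: transpose_matrix_vector)
        then show thesis using that[of "c\<^sup>2"] c by simp
      qed
      obtain g where g: "g > 0" "\<And>x. x \<bullet> (G *v x) \<le> g * (x \<bullet> x)"
      proof -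
        obtain c where c: "c > 0" "\<And>x. norm (G *v x) \<le> c * norm x"
          using matrix_vector_norm_bound by blast
        have "x \<bullet> (G *v x) \<le> c * (x \<bullet> x)" for x
        proof -
          have "x \<bullet> (G *v x) \<le> norm x * norm (G *v x)" by (rule norm_cauchy_schwarz)
          also have "\<dots> \<le> norm x * (c * norm x)" by (intro mult_left_mono c) auto
          finally show ?thesis by (simp add: dot_square_norm power2_eq_square mult_ac)
        qed
        then show thesis using that[of c] c by simp
      qed
      \<comment> \<open>The gain \<open>\<epsilon> \<delta>\<close> pays for the second-order term \<open>\<epsilon>\<^sup>2 m / \<gamma>\<close> and for the increase of \<open>\<tau>\<close>, half each.\<close>
      define \<epsilon> where "\<epsilon> = min 1 (\<delta> * \<gamma> / (2 * m))"
      have \<epsilon>: "0 < \<epsilon>" "\<epsilon> \<le> 1" "\<epsilon> * m / \<gamma> \<le> \<delta> / 2"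
        using \<delta> \<gamma> m by (auto simp: \<epsilon>_def field_simps min_def)
      define \<tau>' where "\<tau>' = min 1 (\<tau> + \<epsilon> * \<delta> * \<gamma> / (2 * g))"
      have "0 < \<epsilon> * \<delta> * \<gamma> / (2 * g)" using \<epsilon> \<delta> \<gamma> g by simp
      then have \<tau>': "\<tau> < \<tau>'" "\<tau>' \<le> 1" "\<tau>' - \<tau> \<le> \<epsilon> * \<delta> * \<gamma> / (2 * g)"
        using \<open>\<tau> < 1\<close> by (auto simp: \<tau>'_def)
      have "(\<tau>' - \<tau>) * g \<le> \<epsilon> * \<delta> * \<gamma> / (2 * g) * g"
        using g \<tau>' by (intro mult_right_mono) auto
      then have \<tau>g: "(\<tau>' - \<tau>) * g / \<gamma> \<le> \<epsilon> * \<delta> / 2"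
        using g \<gamma> by (simp add: field_simps)
      have "r \<tau>' (P + \<epsilon> *\<^sub>R H) x \<le> 0" for x
      proof -
        have "r \<tau>' (P + \<epsilon> *\<^sub>R H) x = (1 - \<epsilon>) * r \<tau> P x + \<epsilon> * (r \<tau> P x + 2 * ((H *v x) \<bullet> (D *v x)))
            + \<epsilon>\<^sup>2 * (norm (transpose Bw *v (H *v x)))\<^sup>2 / \<gamma> + (\<tau>' - \<tau>) * (x \<bullet> (G *v x)) / \<gamma>"
          unfolding r_def riccati_form_perturb[OF \<gamma> D_def, of G \<tau>' \<epsilon> H x \<tau>] by (simp add: algebra_simps)
        also have "\<dots> \<le> 0 + \<epsilon> * (- \<delta> * (x \<bullet> x)) + \<epsilon>\<^sup>2 * (m * (x \<bullet> x)) / \<gamma> + (\<tau>' - \<tau>) * (g * (x \<bullet> x)) / \<gamma>"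
          using \<epsilon> \<tau>' \<gamma> P(2)[of x] \<delta>'[of x] m(2)[of x] g(2)[of x]
          by (intro add_mono mult_left_mono divide_right_mono) (auto intro!: mult_nonneg_nonpos)
        also have "\<dots> = (- \<epsilon> * \<delta> + \<epsilon> * (\<epsilon> * m / \<gamma>) + (\<tau>' - \<tau>) * g / \<gamma>) * (x \<bullet> x)"
          by (simp add: algebra_simps power2_eq_square)
        also have "\<dots> \<le> (- \<epsilon> * \<delta> + \<epsilon> * (\<delta> / 2) + \<epsilon> * \<delta> / 2) * (x \<bullet> x)"
        proof (rule mult_right_mono)
          have "\<epsilon> * (\<epsilon> * m / \<gamma>) \<le> \<epsilon> * (\<delta> / 2)"
            using \<epsilon> by (intro mult_left_mono) auto
          then show "- \<epsilon> * \<delta> + \<epsilon> * (\<epsilon> * m / \<gamma>) + (\<tau>' - \<tau>) * g / \<gamma> \<le> - \<epsilon> * \<delta> + \<epsilon> * (\<delta> / 2) + \<epsilon> * \<delta> / 2"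
            using \<tau>g by linarith
        qed simp
        finally show ?thesis by simp
      qed
      moreover have "pos_semidef (P + \<epsilon> *\<^sub>R H)"
        unfolding pos_semidef_def
      proof safe
        show "transpose (P + \<epsilon> *\<^sub>R H) = P + \<epsilon> *\<^sub>R H" using symP step(1) by (simp add: transpose_simps)
        fix x
        have "x \<bullet> ((P + \<epsilon> *\<^sub>R H) *v x) = (1 - \<epsilon>) * (x \<bullet> (P *v x)) + \<epsilon> * (x \<bullet> ((P + H) *v x))"
          by (simp add: matrix_vector_left_simps inner_add_right algebra_simps)
        also have "\<dots> \<ge> 0"
          using \<epsilon> P(1) pos_def_imp_pos_semidef[OF step(2)] by (simp add: pos_semidef_def)
        finally show "0 \<le> x \<bullet> ((P + \<epsilon> *\<^sub>R H) *v x)" .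
      qed
      ultimately have "(\<tau>', P + \<epsilon> *\<^sub>R H) \<in> T" using \<tau> \<tau>' by (simp add: T_iff)
      from z(2)[OF this] show False using \<tau>' by (simp add: z1)
    next
      case (eigenpair a b x y)
      show False
      proof (cases "\<tau> = 0")
        case True
        then have "D = F" by (simp add: D_def P_def matrix_mult_bilinear_simps)
        then have "Complex a b \<in> eigenvalues (cmat F)"
          unfolding eigenvalue_cmat_iff using eigenpair(1-3) by auto
        from Hurwitz[OF this] show False using eigenpair(6) by simp
      next
        case False
        then have "a = 0" using Pdef eigenpair(7) by blast
        then have "x = 0 \<and> y = 0"
          using eigenpair N unfolding r_def
          by (intro riccati_no_imaginary_eigenpair[OF \<gamma> G \<open>\<tau> < 1\<close> symP freq D_def]) auto
        then show False using eigenpair(1) by blast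
      qed
    qed
  qed
  with \<tau> have "\<tau> = 1" by simp
  have P1': "riccati_form F Bw G \<gamma> 1 P1 x \<le> 0" for x
    using P1(2)[of x] by (simp only: r_def \<open>\<tau> = 1\<close>)
  show thesis
    by (rule that[OF riccati_form_pos_def[OF G \<gamma> zero_less_one P1(1) P1'] P1'])
qed

section \<open>Block matrices and the \<open>H\<^sub>\<infinity>\<close> norm\<close>

lemma sum_UNIV_sum:
  "(\<Sum>i\<in>(UNIV :: ('p::finite + 'q::finite) set). f i) = (\<Sum>i\<in>UNIV. f (Inl i)) + (\<Sum>i\<in>UNIV. f (Inr i))"
proof -
  have "sum f (UNIV <+> UNIV) = (\<Sum>i\<in>UNIV. f (Inl i)) + (\<Sum>i\<in>UNIV. f (Inr i))"
    by (subst sum.Plus) (auto simp: o_def)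
  then show ?thesis by (simp only: UNIV_Plus_UNIV)
qed

text \<open>The column vector with the blocks \<open>x\<close> and \<open>y\<close>.\<close>

definition vjoin :: "'a ^ 'p \<Rightarrow> 'a ^ 'q \<Rightarrow> 'a ^ ('p + 'q)"
  where "vjoin x y = (\<chi> i. case i of Inl k \<Rightarrow> x $ k | Inr k \<Rightarrow> y $ k)"

lemma vjoin_cases: obtains x y where "z = vjoin x y"
proof
  show "z = vjoin (\<chi> i. z $ Inl i) (\<chi> i. z $ Inr i)"
    by (simp add: vjoin_def vec_eq_iff split: sum.split)
qed

lemma inner_vjoin: "vjoin x y \<bullet> vjoin x' y' = x \<bullet> x' + y \<bullet> y'" for x x' :: "'a::real_inner ^ 'p"
  by (simp add: inner_vec_def sum_UNIV_sum vjoin_def)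

lemma norm_vjoin: "(norm (vjoin x y))\<^sup>2 = (norm x)\<^sup>2 + (norm y)\<^sup>2" for x :: "'a::real_inner ^ 'p"
  by (simp add: power2_norm_eq_inner inner_vjoin)

lemma vcat_mult: "(M /// N) *v z = vjoin (M *v z) (N *v z)"
  by (simp add: vec_eq_iff vcat_def vjoin_def matrix_vector_mult_def split: sum.split)

lemma hcat_mult: "(M ||| N) *v vjoin x y = M *v x + N *v y"
  by (simp add: vec_eq_iff hcat_def vjoin_def matrix_vector_mult_def sum_UNIV_sum)

text \<open>Semidefiniteness of a symmetric arrow-shaped block matrix in terms of its quadratic form.\<close>

lemma neg_semidef_block_iff:
  fixes M1 :: "real ^ 'n ^ 'n" and M2 :: "real ^ 'p ^ 'n" and M3 :: "real ^ 'q ^ 'n" and M4 :: "real ^ 'r ^ 'n"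
  assumes "transpose M1 = M1" "transpose M2 = N2" "transpose M3 = N3" "transpose M4 = N4"
  shows "neg_semidef ((M1 ||| M2 ||| M3 ||| M4) ///
      (N2 ||| - \<gamma> *\<^sub>R mat 1 ||| 0 ||| 0) ///
      (N3 ||| 0 ||| - \<gamma> *\<^sub>R mat 1 ||| 0) ///
      (N4 ||| 0 ||| 0 ||| - \<gamma> *\<^sub>R mat 1)) \<longleftrightarrow>
    (\<forall>x w a b. x \<bullet> (M1 *v x) + 2 * (x \<bullet> (M2 *v w)) + 2 * (x \<bullet> (M3 *v a)) + 2 * (x \<bullet> (M4 *v b))
      - \<gamma> * (w \<bullet> w + a \<bullet> a + b \<bullet> b) \<le> 0)" (is "neg_semidef ?M \<longleftrightarrow> ?R")
proof -
  have entries: "M1 $ i $ j = M1 $ j $ i" "N2 $ k $ i = M2 $ i $ k" "N3 $ l $ i = M3 $ i $ l" "N4 $ m $ i = M4 $ i $ m"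
    for i j k l m
    using assms by (metis (no_types, lifting) transpose_def vec_lambda_beta)+
  have sym: "transpose ?M = ?M"
    by (auto simp: vec_eq_iff transpose_def hcat_def vcat_def mat_def entries split: sum.split)
  have form: "vjoin x (vjoin w (vjoin a b)) \<bullet> (?M *v vjoin x (vjoin w (vjoin a b))) =
    x \<bullet> (M1 *v x) + 2 * (x \<bullet> (M2 *v w)) + 2 * (x \<bullet> (M3 *v a)) + 2 * (x \<bullet> (M4 *v b))
      - \<gamma> * (w \<bullet> w + a \<bullet> a + b \<bullet> b)" for x w a b
  proof -
    have "w \<bullet> (N2 *v x) = x \<bullet> (M2 *v w)" "a \<bullet> (N3 *v x) = x \<bullet> (M3 *v a)" "b \<bullet> (N4 *v x) = x \<bullet> (M4 *v b)"
      using assms(2-4) by (metis inner_commute inner_matrix_vector transpose_transpose)+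
    then show ?thesis
      by (simp add: vcat_mult hcat_mult inner_vjoin matrix_vector_left_simps inner_add_right algebra_simps)
  qed
  show ?thesis
  proof
    assume "neg_semidef ?M"
    then show ?R unfolding neg_semidef_def form[symmetric] by blast
  next
    assume R: ?R
    show "neg_semidef ?M"
      unfolding neg_semidef_def
    proof safe
      show "transpose ?M = ?M" by (rule sym)
      fix z :: "real ^ ('n + ('p + ('q + 'r)))"
      obtain x z1 where "z = vjoin x z1" using vjoin_cases .
      moreover obtain w z2 where "z1 = vjoin w z2" using vjoin_cases .
      moreover obtain a b where "z2 = vjoin a b" using vjoin_cases .
      ultimately show "z \<bullet> (?M *v z) \<le> 0" using R form by simp
    qed
  qed
qed

lemma inner_complex_mult_left: "(c * x) \<bullet> y = x \<bullet> (cnj c * y)" for x y c :: complex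
  by (simp add: inner_complex_def algebra_simps)

lemma complex_adjoint:
  "(M *v x) \<bullet> y = x \<bullet> (transpose (map_matrix cnj M) *v y)" for M :: "complex ^ 'q ^ 'p"
proof -
  have "(M *v x) \<bullet> y = (\<Sum>i\<in>UNIV. \<Sum>j\<in>UNIV. x $ j \<bullet> (cnj (M $ i $ j) * y $ i))"
    by (simp add: inner_vec_def matrix_vector_mult_def inner_sum_left inner_complex_mult_left)
  also have "\<dots> = (\<Sum>j\<in>UNIV. \<Sum>i\<in>UNIV. x $ j \<bullet> (cnj (M $ i $ j) * y $ i))"
    by (rule sum.swap)
  also have "\<dots> = x \<bullet> (transpose (map_matrix cnj M) *v y)"
    by (simp add: inner_vec_def matrix_vector_mult_def inner_sum_right transpose_def map_matrix_def)
  finally show ?thesis .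
qed

lemma complex_of_real_scale: "complex_of_real r *s v = r *\<^sub>R v"
  unfolding vec_eq_iff vector_smult_component vector_scaleR_component by (simp add: scaleR_conv_of_real)

lemma singular_values_finite: "finite (singular_values M)"
proof (rule finite_subset)
  show "singular_values M \<subseteq> (\<lambda>l. sqrt (Re l)) ` eigenvalues (transpose (map_matrix cnj M) ** M)"
  proof
    fix s assume "s \<in> singular_values M"
    then show "s \<in> (\<lambda>l. sqrt (Re l)) ` eigenvalues (transpose (map_matrix cnj M) ** M)"
      by (intro rev_image_eqI[of "complex_of_real (s\<^sup>2)"]) (auto simp: singular_values_def)
  qed
qed (intro finite_imageI eigenvalues_finite)

text \<open>The norm of \<open>M\<close> is a singular value, because a maximizer of \<open>\<parallel>M w\<parallel>\<close> on the unit sphere is in the kernel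
  of the positive semidefinite map \<open>s\<^sup>2 I - M\<^sup>* M\<close>.\<close>

lemma norm_singular_value:
  fixes M :: "complex ^ 'q ^ 'p"
  obtains s where "s \<in> singular_values M" "\<And>w. norm (M *v w) \<le> s * norm w"
proof -
  define H where "H w = transpose (map_matrix cnj M) *v (M *v w)" for w
  have H: "(H x) \<bullet> y = (M *v x) \<bullet> (M *v y)" "x \<bullet> H y = (M *v x) \<bullet> (M *v y)" for x y
    unfolding H_def by (metis complex_adjoint inner_commute)+
  have "axis undefined 1 \<in> sphere (0 :: complex ^ 'q) 1" by simp
  moreover have "continuous_on (sphere 0 1) (\<lambda>w. norm (M *v w))"
    by (intro continuous_intros linear_continuous_on matrix_vector_mul_bounded_linear)
  ultimately obtain w where w: "w \<in> sphere 0 1" "\<And>v. v \<in> sphere 0 1 \<Longrightarrow> norm (M *v v) \<le> norm (M *v w)"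
    using continuous_attains_sup[OF compact_sphere, of 0 1 "\<lambda>w. norm (M *v w)"] by blast
  define s where "s = norm (M *v w)"
  have bound: "norm (M *v v) \<le> s * norm v" for v
  proof (cases "v = 0")
    case False
    have "M *v sgn v = inverse (norm v) *\<^sub>R (M *v v)"
      using linear_scale[OF bounded_linear.linear[OF matrix_vector_mul_bounded_linear[of M]], of "inverse (norm v)" v]
      by (simp add: sgn_div_norm)
    moreover have "norm (M *v sgn v) \<le> s"
      unfolding s_def using False by (intro w(2)) (simp add: norm_sgn)
    ultimately show ?thesis using False by (simp add: field_simps)
  qed auto
  have linH: "linear H"
    unfolding H_def
    by (intro linear_compose[of "(*v) M" "(*v) (transpose (map_matrix cnj M))", unfolded o_def]
        bounded_linear.linear[OF matrix_vector_mul_bounded_linear])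
  have "s\<^sup>2 *\<^sub>R w - H w = 0"
  proof (rule nonneg_form_eq_0_imp_kernel[where T = "\<lambda>v. s\<^sup>2 *\<^sub>R v - H v"])
    show "linear (\<lambda>v. s\<^sup>2 *\<^sub>R v - H v)"
      by (intro linear_compose_sub linear_compose_scale_right linear_id linH linear_ident)
    show "(s\<^sup>2 *\<^sub>R x - H x) \<bullet> y = x \<bullet> (s\<^sup>2 *\<^sub>R y - H y)" for x y
      by (simp add: inner_diff H)
    show "0 \<le> x \<bullet> (s\<^sup>2 *\<^sub>R x - H x)" for x
      using power_mono[OF bound[of x], of 2]
      by (simp add: inner_diff H power_mult_distrib power2_norm_eq_inner)
    show "w \<bullet> (s\<^sup>2 *\<^sub>R w - H w) = 0"
      using w(1) by (simp add: inner_diff H s_def dot_square_norm)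
  qed
  then have "H w = complex_of_real (s\<^sup>2) *s w" by (simp only: complex_of_real_scale eq_iff_diff_eq_0[symmetric])
  moreover have "w \<noteq> 0" using w(1) by auto
  ultimately have "s \<in> singular_values M"
    unfolding singular_values_def eigenvalues_def
    by (auto simp: s_def H_def matrix_vector_mul_assoc[symmetric] intro!: exI[of _ w])
  with bound that show thesis by blast
qed

lemma sigma_max_le_iff:
  fixes M :: "complex ^ 'q ^ 'p"
  shows "sigma_max M \<le> \<gamma> \<longleftrightarrow> 0 \<le> \<gamma> \<and> (\<forall>w. norm (M *v w) \<le> \<gamma> * norm w)"
proof -
  obtain s where s: "s \<in> singular_values M" "\<And>w. norm (M *v w) \<le> s * norm w"
    using norm_singular_value by blast
  have le: "sigma_max M \<le> \<gamma> \<longleftrightarrow> (\<forall>t\<in>singular_values M. t \<le> \<gamma>)"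
    unfolding sigma_max_def using singular_values_finite s by (intro Max_le_iff) auto
  show ?thesis
  proof
    assume "sigma_max M \<le> \<gamma>"
    then have "s \<le> \<gamma>" using le s by blast
    moreover have "0 \<le> s" using s(1) by (simp add: singular_values_def)
    ultimately show "0 \<le> \<gamma> \<and> (\<forall>w. norm (M *v w) \<le> \<gamma> * norm w)"
      using s(2) by (meson mult_right_mono norm_ge_zero order_trans)
  next
    assume R: "0 \<le> \<gamma> \<and> (\<forall>w. norm (M *v w) \<le> \<gamma> * norm w)"
    show "sigma_max M \<le> \<gamma>"
      unfolding le
    proof
      fix t assume "t \<in> singular_values M"
      then obtain v where t: "0 \<le> t" and v: "v \<noteq> 0"
        and eig: "transpose (map_matrix cnj M) *v (M *v v) = t\<^sup>2 *\<^sub>R v"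
        unfolding singular_values_def eigenvalues_def
        by (auto simp: complex_of_real_scale matrix_vector_mul_assoc simp del: of_real_power)
      have "(norm (M *v v))\<^sup>2 = t\<^sup>2 * (norm v)\<^sup>2"
        unfolding power2_norm_eq_inner complex_adjoint eig by simp
      moreover have "(norm (M *v v))\<^sup>2 \<le> (\<gamma> * norm v)\<^sup>2"
        using R by (intro power_mono) auto
      ultimately have "(t * norm v)\<^sup>2 \<le> (\<gamma> * norm v)\<^sup>2" by (simp add: power_mult_distrib)
      then have "t * norm v \<le> \<gamma> * norm v" using R by (intro power2_le_imp_le[of "t * norm v"]) auto
      then show "t \<le> \<gamma>" using v by simp
    qed
  qed
qed

lemma mat_mult_vec: "mat s *v v = s *s v" for v :: "'a::comm_ring_1 ^ 'n"
  by (simp add: vec_eq_iff matrix_vector_mult_def mat_def if_distrib if_distribR cong: if_cong)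

lemma stabilizing_resolvent_invertible:
  assumes "K \<in> stabilizing A B"
  shows "invertible (mat (\<i> * complex_of_real \<omega>) - cmat (A + B ** K))"
proof -
  have "\<i> * complex_of_real \<omega> \<notin> eigenvalues (cmat (A + B ** K))"
    using assms unfolding stabilizing_iff by force
  then show ?thesis by (simp add: eigenvalue_iff_det invertible_det_nz)
qed

text \<open>The \<open>H\<^sub>\<infinity>\<close> bound as a frequency-domain inequality, in real coordinates: \<open>x + i y\<close> is the state and
  \<open>p + i q\<close> the disturbance at frequency \<open>\<omega>\<close>.\<close>

lemma J_inf_le_iff:
  fixes A :: "real ^ 'n ^ 'n" and B :: "real ^ 'm ^ 'n" and Bw Q :: "real ^ 'n ^ 'n" and R :: "real ^ 'm ^ 'm"
  assumes K: "K \<in> stabilizing A B"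
  shows "J_inf A B Bw Q R K \<le> ereal \<gamma> \<longleftrightarrow> 0 \<le> \<gamma> \<and> (\<forall>\<omega> x y p q.
     Bw *v p = - \<omega> *\<^sub>R y - (A + B ** K) *v x \<longrightarrow> Bw *v q = \<omega> *\<^sub>R x - (A + B ** K) *v y \<longrightarrow>
     (norm (mat_sqrt Q *v x))\<^sup>2 + (norm (mat_sqrt R *v (K *v x)))\<^sup>2
       + ((norm (mat_sqrt Q *v y))\<^sup>2 + (norm (mat_sqrt R *v (K *v y)))\<^sup>2) \<le> \<gamma>\<^sup>2 * (p \<bullet> p + q \<bullet> q))"
proof -
  define F C where "F = A + B ** K" and "C = (mat_sqrt Q /// mat_sqrt R ** K)"
  define S where "S \<omega> = mat (\<i> * complex_of_real \<omega>) - cmat F" for \<omega>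
  define T where "T \<omega> = Tzw A B Bw Q R K (\<i> * complex_of_real \<omega>)" for \<omega>
  have T: "T \<omega> *v w = cmat C *v (matrix_inv (S \<omega>) *v (cmat Bw *v w))" for \<omega> and w :: "complex ^ 'n"
    by (simp add: T_def Tzw_def C_def S_def F_def matrix_vector_mul_assoc matrix_mul_assoc)
  have S: "invertible (S \<omega>)" for \<omega>
    unfolding S_def F_def by (rule stabilizing_resolvent_invertible[OF K])
  have Smult: "S \<omega> *v cvec x y = cvec (- \<omega> *\<^sub>R y - F *v x) (\<omega> *\<^sub>R x - F *v y)" for \<omega> x y
    by (simp add: S_def matrix_vector_mult_diff_rdistrib mat_mult_vec cmat_mult_cvec cvec_scale cvec_diff)
  have C: "(norm (C *v x))\<^sup>2 = (norm (mat_sqrt Q *v x))\<^sup>2 + (norm (mat_sqrt R *v (K *v x)))\<^sup>2" for x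
    by (simp add: C_def vcat_mult norm_vjoin matrix_vector_mul_assoc)
  have "J_inf A B Bw Q R K \<le> ereal \<gamma> \<longleftrightarrow> (\<forall>\<omega>. sigma_max (T \<omega>) \<le> \<gamma>)"
    by (simp add: J_inf_def Hinf_norm_def SUP_le_iff T_def)
  also have "\<dots> \<longleftrightarrow> 0 \<le> \<gamma> \<and> (\<forall>\<omega> w. norm (T \<omega> *v w) \<le> \<gamma> * norm w)"
    unfolding sigma_max_le_iff by blast
  also have "\<dots> \<longleftrightarrow> 0 \<le> \<gamma> \<and> (\<forall>\<omega> x y p q. Bw *v p = - \<omega> *\<^sub>R y - F *v x \<longrightarrow> Bw *v q = \<omega> *\<^sub>R x - F *v y \<longrightarrow>
     (norm (C *v x))\<^sup>2 + (norm (C *v y))\<^sup>2 \<le> \<gamma>\<^sup>2 * (p \<bullet> p + q \<bullet> q))"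
  proof (rule conj_cong[OF refl])
    assume \<gamma>: "0 \<le> \<gamma>"
    have sq: "norm (T \<omega> *v w) \<le> \<gamma> * norm w \<longleftrightarrow> (norm (T \<omega> *v w))\<^sup>2 \<le> \<gamma>\<^sup>2 * (norm w)\<^sup>2" for \<omega> w
      using \<gamma> by (metis abs_le_square_iff abs_of_nonneg mult_nonneg_nonneg norm_ge_zero power_mult_distrib)
    have norm2: "(norm (T \<omega> *v w))\<^sup>2 = (norm (C *v x))\<^sup>2 + (norm (C *v y))\<^sup>2"
      if "S \<omega> *v cvec x y = cmat Bw *v w" for \<omega> x y and w :: "complex ^ 'n"
    proof -
      have "matrix_inv (S \<omega>) *v (cmat Bw *v w) = cvec x y"
        unfolding that[symmetric] matrix_vector_mul_assoc matrix_inv_mult_left[OF S] by simp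
      then show ?thesis by (simp add: T cmat_mult_cvec norm_cvec)
    qed
    show "(\<forall>\<omega> w. norm (T \<omega> *v w) \<le> \<gamma> * norm w) \<longleftrightarrow> (\<forall>\<omega> x y p q.
        Bw *v p = - \<omega> *\<^sub>R y - F *v x \<longrightarrow> Bw *v q = \<omega> *\<^sub>R x - F *v y \<longrightarrow>
        (norm (C *v x))\<^sup>2 + (norm (C *v y))\<^sup>2 \<le> \<gamma>\<^sup>2 * (p \<bullet> p + q \<bullet> q))" (is "?L \<longleftrightarrow> ?R")
    proof
      assume L: ?L
      show ?R
      proof (intro allI impI)
        fix \<omega> x y p q
        assume "Bw *v p = - \<omega> *\<^sub>R y - F *v x" "Bw *v q = \<omega> *\<^sub>R x - F *v y"
        then have "S \<omega> *v cvec x y = cmat Bw *v cvec p q" by (simp add: Smult cmat_mult_cvec)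
        from norm2[OF this] show "(norm (C *v x))\<^sup>2 + (norm (C *v y))\<^sup>2 \<le> \<gamma>\<^sup>2 * (p \<bullet> p + q \<bullet> q)"
          using L[unfolded sq, rule_format, of \<omega> "cvec p q"] by (simp add: power2_norm_eq_inner inner_cvec)
      qed
    next
      assume R: ?R
      show ?L
      proof (intro allI)
        fix \<omega> and w :: "complex ^ 'n"
        obtain p q where w: "w = cvec p q" using cvec_cases .
        obtain x y where v: "matrix_inv (S \<omega>) *v (cmat Bw *v w) = cvec x y" using cvec_cases .
        have Sv: "S \<omega> *v cvec x y = cmat Bw *v w"
          unfolding v[symmetric] matrix_vector_mul_assoc matrix_mul_assoc matrix_inv_mult_right[OF S] by simp
        then have "Bw *v p = - \<omega> *\<^sub>R y - F *v x" "Bw *v q = \<omega> *\<^sub>R x - F *v y"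
          by (simp_all add: Smult w cmat_mult_cvec)
        then have "(norm (C *v x))\<^sup>2 + (norm (C *v y))\<^sup>2 \<le> \<gamma>\<^sup>2 * (p \<bullet> p + q \<bullet> q)"
          by (rule R[rule_format])
        also have "p \<bullet> p + q \<bullet> q = (norm w)\<^sup>2"
          by (simp only: w inner_cvec power2_norm_eq_inner)
        finally show "norm (T \<omega> *v w) \<le> \<gamma> * norm w"
          unfolding sq norm2[OF Sv] .
      qed
    qed
  qed
  finally show ?thesis unfolding C F_def .
qed

section \<open>The matrix inequality of the lifted set\<close>

text \<open>The quadratic form of both matrix inequalities, in the vectors \<open>z\<close>, \<open>v\<close>, \<open>s\<close>, \<open>t\<close> that depend linearly on
  the first block of the argument, and in the remaining blocks \<open>w\<close>, \<open>a\<close>, \<open>b\<close>.\<close>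

definition arrow_form :: "real ^ 'n ^ 'n \<Rightarrow> real \<Rightarrow> real ^ 'n \<Rightarrow> real ^ 'n \<Rightarrow> real ^ 'n \<Rightarrow> real ^ 'm
    \<Rightarrow> real ^ 'n \<Rightarrow> real ^ 'n \<Rightarrow> real ^ 'm \<Rightarrow> real"
  where "arrow_form Bw \<gamma> z v s t w a b = 2 * (z \<bullet> v) + 2 * (z \<bullet> (Bw *v w)) + 2 * (s \<bullet> a) + 2 * (t \<bullet> b)
    - \<gamma> * (w \<bullet> w + a \<bullet> a + b \<bullet> b)"

text \<open>For \<open>\<gamma> \<le> 0\<close> the form is unbounded above along \<open>a = k s\<close>.\<close>

lemma arrow_form_nonpos_imp_gamma_pos:
  fixes s :: "real ^ 'n" and t :: "real ^ 'm"
  assumes nonpos: "\<And>w a b. arrow_form Bw \<gamma> z v s t w a b \<le> 0" and "s \<noteq> 0"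
  shows "\<gamma> > 0"
proof (rule ccontr)
  assume "\<not> \<gamma> > 0"
  define k where "k = (\<bar>z \<bullet> v\<bar> + 1) / (s \<bullet> s)"
  have "k * (s \<bullet> s) = \<bar>z \<bullet> v\<bar> + 1" using \<open>s \<noteq> 0\<close> by (simp add: k_def)
  moreover have "2 * (z \<bullet> v) + 2 * (k * (s \<bullet> s)) - \<gamma> * (k\<^sup>2 * (s \<bullet> s)) \<le> 0"
    using nonpos[of 0 "k *\<^sub>R s" 0] by (simp add: arrow_form_def power2_eq_square mult.assoc)
  moreover have "\<gamma> * (k\<^sup>2 * (s \<bullet> s)) \<le> 0"
    using \<open>\<not> \<gamma> > 0\<close> by (intro mult_nonpos_nonneg) auto
  ultimately show False by linarith
qed

text \<open>Schur complement, by completion of squares.\<close>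

lemma arrow_form_nonpos_iff:
  fixes s :: "real ^ 'n" and t :: "real ^ 'm"
  assumes \<gamma>: "\<gamma> > 0"
  shows "(\<forall>w a b. arrow_form Bw \<gamma> z v s t w a b \<le> 0) \<longleftrightarrow>
    2 * (z \<bullet> v) + ((norm (transpose Bw *v z))\<^sup>2 + ((norm s)\<^sup>2 + (norm t)\<^sup>2)) / \<gamma> \<le> 0" (is "?L \<longleftrightarrow> ?c \<le> 0")
proof -
  have max: "2 * (c \<bullet> w) - \<gamma> * (w \<bullet> w) = (norm c)\<^sup>2 / \<gamma> - \<gamma> * (norm (w - (1 / \<gamma>) *\<^sub>R c))\<^sup>2" for c w :: "real ^ 'k"
  proof -
    have "(norm (w - (1 / \<gamma>) *\<^sub>R c))\<^sup>2 = w \<bullet> w - 2 / \<gamma> * (c \<bullet> w) + (c \<bullet> c) / \<gamma>\<^sup>2"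
      unfolding power2_norm_eq_inner by (simp add: inner_diff inner_commute power2_eq_square)
    then show ?thesis
      using \<gamma> unfolding power2_norm_eq_inner[of c] by (simp add: field_simps power2_eq_square)
  qed
  define d where "d w a b = (norm (w - (1 / \<gamma>) *\<^sub>R (transpose Bw *v z)))\<^sup>2 + (norm (a - (1 / \<gamma>) *\<^sub>R s))\<^sup>2
    + (norm (b - (1 / \<gamma>) *\<^sub>R t))\<^sup>2" for w a b
  have form: "arrow_form Bw \<gamma> z v s t w a b = ?c - \<gamma> * d w a b" for w a b
  proof -
    have "arrow_form Bw \<gamma> z v s t w a b = 2 * (z \<bullet> v) + (2 * ((transpose Bw *v z) \<bullet> w) - \<gamma> * (w \<bullet> w))
        + (2 * (s \<bullet> a) - \<gamma> * (a \<bullet> a)) + (2 * (t \<bullet> b) - \<gamma> * (b \<bullet> b))"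
      unfolding arrow_form_def inner_matrix_vector by (simp add: algebra_simps)
    then show ?thesis
      unfolding max d_def by (simp add: algebra_simps add_divide_distrib)
  qed
  show ?thesis
  proof
    assume ?L
    then have "arrow_form Bw \<gamma> z v s t ((1 / \<gamma>) *\<^sub>R (transpose Bw *v z)) ((1 / \<gamma>) *\<^sub>R s) ((1 / \<gamma>) *\<^sub>R t) \<le> 0"
      by blast
    then show "?c \<le> 0" unfolding form by (simp add: d_def)
  next
    assume c: "?c \<le> 0"
    have "0 \<le> \<gamma> * d w a b" for w a b using \<gamma> by (simp add: d_def)
    with c show ?L unfolding form by (meson diff_le_0_iff_le order_trans)
  qed
qed

lemma transpose_mat_sqrt: "pos_def Q \<Longrightarrow> transpose (mat_sqrt Q) = mat_sqrt Q"
  by (metis mat_sqrt(1) pos_def_def)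

lemma mat_sqrt_nonzero: "pos_def Q \<Longrightarrow> x \<noteq> 0 \<Longrightarrow> mat_sqrt Q *v x \<noteq> 0"
  using mat_sqrt(1) unfolding pos_def_def by (metis inner_zero_right less_irrefl)

lemma norm_mat_sqrt:
  assumes "pos_def Q" shows "(norm (mat_sqrt Q *v x))\<^sup>2 = x \<bullet> (Q *v x)"
proof -
  have "x \<bullet> (Q *v x) = x \<bullet> (mat_sqrt Q *v (mat_sqrt Q *v x))"
    by (simp add: matrix_vector_mul_assoc mat_sqrt(2)[OF assms])
  then show ?thesis
    by (simp add: inner_symmetric_matrix[OF transpose_mat_sqrt[OF assms]] power2_norm_eq_inner)
qed

lemma L_inf_iff:
  fixes A :: "real ^ 'n ^ 'n" and B :: "real ^ 'm ^ 'n" and Bw Q :: "real ^ 'n ^ 'n" and R :: "real ^ 'm ^ 'm"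
  assumes Q: "pos_def Q" and R: "pos_def R"
  shows "(K, \<gamma>, P) \<in> L_inf A B Bw Q R \<longleftrightarrow> pos_def P \<and> (\<forall>x w a b.
    arrow_form Bw \<gamma> (P *v x) ((A + B ** K) *v x) (mat_sqrt Q *v x) (mat_sqrt R *v (K *v x)) w a b \<le> 0)"
proof (cases "pos_def P")
  case True
  then have symP: "transpose P = P" by (simp add: pos_def_def)
  note symQ = transpose_mat_sqrt[OF Q] and symR = transpose_mat_sqrt[OF R]
  define F where "F = A + B ** K"
  have form: "x \<bullet> ((transpose F ** P + P ** F) *v x) + 2 * (x \<bullet> ((P ** Bw) *v w)) + 2 * (x \<bullet> (mat_sqrt Q *v a))
      + 2 * (x \<bullet> ((transpose K ** mat_sqrt R) *v b)) - \<gamma> * (w \<bullet> w + a \<bullet> a + b \<bullet> b)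
    = arrow_form Bw \<gamma> (P *v x) (F *v x) (mat_sqrt Q *v x) (mat_sqrt R *v (K *v x)) w a b" for x w a b
  proof -
    have "x \<bullet> (transpose F *v (P *v x)) = (P *v x) \<bullet> (F *v x)"
      by (metis inner_matrix_vector inner_commute transpose_transpose)
    moreover have "x \<bullet> (transpose K *v (mat_sqrt R *v b)) = (mat_sqrt R *v (K *v x)) \<bullet> b"
      by (metis inner_matrix_vector inner_symmetric_matrix symR transpose_transpose)
    ultimately show ?thesis
      by (simp only: arrow_form_def matrix_vector_left_simps matrix_vector_mul_assoc[symmetric] inner_add_right
          inner_symmetric_matrix[OF symP] inner_symmetric_matrix[OF symQ])
  qed
  show ?thesis
    unfolding L_inf_def F_def[symmetric] form[symmetric] mem_Collect_eq case_prod_conv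
    using True symP symQ symR
    by (subst neg_semidef_block_iff)
      (simp_all add: transpose_simps matrix_transpose_mul add.commute)
qed (simp add: L_inf_def)

lemma F_inf_iff:
  fixes A :: "real ^ 'n ^ 'n" and B :: "real ^ 'm ^ 'n" and Bw Q :: "real ^ 'n ^ 'n" and R :: "real ^ 'm ^ 'm"
  assumes Q: "pos_def Q" and R: "pos_def R"
  shows "(\<gamma>, Y, X) \<in> F_inf A B Bw Q R \<longleftrightarrow> pos_def X \<and> (\<forall>x w a b.
    arrow_form Bw \<gamma> x ((A ** X + B ** Y) *v x) (mat_sqrt Q *v (X *v x)) (mat_sqrt R *v (Y *v x)) w a b \<le> 0)"
proof (cases "pos_def X")
  case True
  then have symX: "transpose X = X" by (simp add: pos_def_def)
  note symQ = transpose_mat_sqrt[OF Q] and symR = transpose_mat_sqrt[OF R]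
  have form: "x \<bullet> ((A ** X + B ** Y + X ** transpose A + transpose Y ** transpose B) *v x) + 2 * (x \<bullet> (Bw *v w))
      + 2 * (x \<bullet> ((X ** mat_sqrt Q) *v a)) + 2 * (x \<bullet> ((transpose Y ** mat_sqrt R) *v b))
      - \<gamma> * (w \<bullet> w + a \<bullet> a + b \<bullet> b)
    = arrow_form Bw \<gamma> x ((A ** X + B ** Y) *v x) (mat_sqrt Q *v (X *v x)) (mat_sqrt R *v (Y *v x)) w a b" for x w a b
  proof -
    have t: "x \<bullet> (transpose M *v x) = x \<bullet> (M *v x)" for M :: "real ^ 'n ^ 'n"
      by (metis inner_matrix_vector inner_commute)
    have "A ** X + B ** Y + X ** transpose A + transpose Y ** transpose B
        = (A ** X + B ** Y) + transpose (A ** X + B ** Y)"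
      by (simp add: transpose_simps matrix_transpose_mul symX)
    then have "x \<bullet> ((A ** X + B ** Y + X ** transpose A + transpose Y ** transpose B) *v x)
        = 2 * (x \<bullet> ((A ** X + B ** Y) *v x))"
      by (simp only: matrix_vector_mult_add_rdistrib[of "A ** X + B ** Y"] inner_add_right[of x "(A ** X + B ** Y) *v x"] t)
    moreover have "x \<bullet> (transpose Y *v (mat_sqrt R *v b)) = (mat_sqrt R *v (Y *v x)) \<bullet> b"
      by (metis inner_matrix_vector inner_symmetric_matrix symR transpose_transpose)
    moreover have "x \<bullet> (X *v (mat_sqrt Q *v a)) = (mat_sqrt Q *v (X *v x)) \<bullet> a"
      by (simp only: inner_symmetric_matrix[OF symX] inner_symmetric_matrix[OF symQ])
    ultimately show ?thesis
      unfolding arrow_form_def by (simp only: matrix_vector_mul_assoc[symmetric])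
  qed
  show ?thesis
    unfolding F_inf_def form[symmetric] mem_Collect_eq case_prod_conv
    using True symX symQ symR
    by (subst neg_semidef_block_iff)
      (simp_all add: transpose_simps matrix_transpose_mul add_ac)
qed (simp add: F_inf_def)

text \<open>The matrix \<open>Q + K\<^sup>T R K\<close> of the squared norm of the performance output.\<close>

definition output_weight :: "real ^ 'n ^ 'n \<Rightarrow> real ^ 'm ^ 'm \<Rightarrow> real ^ 'n ^ 'm \<Rightarrow> real ^ 'n ^ 'n"
  where "output_weight Q R K = Q + transpose K ** R ** K"

lemma output_weight_form:
  assumes "pos_def Q" "pos_def R"
  shows "x \<bullet> (output_weight Q R K *v x) = (norm (mat_sqrt Q *v x))\<^sup>2 + (norm (mat_sqrt R *v (K *v x)))\<^sup>2"
proof -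
  have "x \<bullet> (transpose K *v (R *v (K *v x))) = (K *v x) \<bullet> (R *v (K *v x))"
    by (metis inner_matrix_vector transpose_transpose)
  then show ?thesis
    unfolding output_weight_def norm_mat_sqrt[OF assms(1)] norm_mat_sqrt[OF assms(2)]
    by (simp only: matrix_vector_left_simps inner_add_right matrix_vector_mul_assoc[symmetric])
qed

lemma pos_def_output_weight:
  assumes Q: "pos_def Q" and R: "pos_def R"
  shows "pos_def (output_weight Q R K)"
  unfolding pos_def_def
proof safe
  show "transpose (output_weight Q R K) = output_weight Q R K"
    using Q R by (simp add: output_weight_def transpose_simps matrix_transpose_mul pos_def_def matrix_mul_assoc)
  fix x :: "real ^ 'a" assume "x \<noteq> 0"
  then have "(norm (mat_sqrt Q *v x))\<^sup>2 > 0"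
    using mat_sqrt_nonzero[OF Q] by simp
  then show "0 < x \<bullet> (output_weight Q R K *v x)"
    unfolding output_weight_form[OF Q R] by (simp add: add_pos_nonneg)
qed

lemma L_inf_gamma_pos:
  assumes Q: "pos_def Q" and R: "pos_def R" and L: "(K, \<gamma>, P) \<in> L_inf A B Bw Q R"
  shows "\<gamma> > 0"
proof -
  have "mat_sqrt Q *v axis undefined 1 \<noteq> 0"
    by (intro mat_sqrt_nonzero Q) (simp add: axis_eq_0_iff)
  then show ?thesis
    using L unfolding L_inf_iff[OF Q R] by (intro arrow_form_nonpos_imp_gamma_pos) auto
qed

lemma L_inf_iff_riccati:
  fixes A :: "real ^ 'n ^ 'n" and B :: "real ^ 'm ^ 'n" and Bw Q :: "real ^ 'n ^ 'n" and R :: "real ^ 'm ^ 'm"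
  assumes Q: "pos_def Q" and R: "pos_def R"
  shows "(K, \<gamma>, P) \<in> L_inf A B Bw Q R \<longleftrightarrow> \<gamma> > 0 \<and> pos_def P \<and>
    (\<forall>x. riccati_form (A + B ** K) Bw (output_weight Q R K) \<gamma> 1 P x \<le> 0)"
proof (cases "\<gamma> > 0")
  case True
  then show ?thesis
    unfolding L_inf_iff[OF Q R] riccati_form_def output_weight_form[OF Q R] mult_1
    using arrow_form_nonpos_iff[OF True] by blast
next
  case False
  then show ?thesis using L_inf_gamma_pos[OF Q R] by blast
qed

text \<open>The Lyapunov inequality \<open>F\<^sup>T P + P F \<prec> 0\<close> with \<open>P \<succ> 0\<close> makes \<open>F\<close> Hurwitz.\<close>

lemma L_inf_imp_stabilizing:
  assumes Q: "pos_def Q" and R: "pos_def R" and L: "(K, \<gamma>, P) \<in> L_inf A B Bw Q R"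
  shows "K \<in> stabilizing A B"
  unfolding stabilizing_iff
proof
  define F G where "F = A + B ** K" and "G = output_weight Q R K"
  have \<gamma>: "\<gamma> > 0" and P: "pos_def P" and r: "riccati_form F Bw G \<gamma> 1 P x \<le> 0" for x
    using L unfolding L_inf_iff_riccati[OF Q R] F_def G_def by auto
  have symP: "transpose P = P" using P by (simp add: pos_def_def)
  have neg: "2 * ((P *v x) \<bullet> (F *v x)) \<le> - (x \<bullet> (G *v x)) / \<gamma>" for x
  proof -
    have "2 * ((P *v x) \<bullet> (F *v x)) + (x \<bullet> (G *v x)) / \<gamma> + (norm (transpose Bw *v (P *v x)))\<^sup>2 / \<gamma> \<le> 0"
      using r[of x] by (simp add: riccati_form_def add_divide_distrib)
    moreover have "0 \<le> (norm (transpose Bw *v (P *v x)))\<^sup>2 / \<gamma>" using \<gamma> by simp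
    ultimately have "2 * ((P *v x) \<bullet> (F *v x)) + (x \<bullet> (G *v x)) / \<gamma> \<le> 0" by linarith
    then show ?thesis by simp
  qed
  fix l assume "l \<in> eigenvalues (cmat (A + B ** K))"
  then obtain x y where xy: "x \<noteq> 0 \<or> y \<noteq> 0"
    and e: "F *v x = Re l *\<^sub>R x - Im l *\<^sub>R y" "F *v y = Im l *\<^sub>R x + Re l *\<^sub>R y"
    unfolding eigenvalue_cmat_iff F_def by blast
  have "(P *v x) \<bullet> y = (P *v y) \<bullet> x"
    using inner_symmetric_matrix[OF symP, of x y] by (simp add: inner_commute)
  then have "(P *v x) \<bullet> (F *v x) + (P *v y) \<bullet> (F *v y) = Re l * (x \<bullet> (P *v x) + y \<bullet> (P *v y))"
    unfolding e by (simp add: inner_diff_right inner_add_right algebra_simps inner_commute)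
  then have "2 * (Re l * (x \<bullet> (P *v x) + y \<bullet> (P *v y))) \<le> - (x \<bullet> (G *v x) + y \<bullet> (G *v y)) / \<gamma>"
    using neg[of x] neg[of y] by (simp add: diff_divide_distrib)
  moreover have pos: "0 < x \<bullet> (M *v x) + y \<bullet> (M *v y)" if "pos_def M" for M
    using xy that unfolding pos_def_def
    by (metis add.commute add.right_neutral add_strict_mono inner_zero_left)
  have "- (x \<bullet> (G *v x) + y \<bullet> (G *v y)) / \<gamma> < 0"
    using pos[of G] pos_def_output_weight[OF Q R] \<gamma> by (simp add: G_def divide_neg_pos)
  ultimately have "Re l * (x \<bullet> (P *v x) + y \<bullet> (P *v y)) < 0" by linarith
  then show "Re l < 0" using pos[OF P] by (simp add: mult_less_0_iff)
qed

lemma L_inf_imp_J_inf_le: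
  fixes A :: "real ^ 'n ^ 'n" and B :: "real ^ 'm ^ 'n" and Bw Q :: "real ^ 'n ^ 'n" and R :: "real ^ 'm ^ 'm"
  assumes Q: "pos_def Q" and R: "pos_def R" and L: "(K, \<gamma>, P) \<in> L_inf A B Bw Q R"
  shows "J_inf A B Bw Q R K \<le> ereal \<gamma>"
proof -
  define F where "F = A + B ** K"
  define g where "g x = (norm (mat_sqrt Q *v x))\<^sup>2 + (norm (mat_sqrt R *v (K *v x)))\<^sup>2" for x
  have \<gamma>: "\<gamma> > 0" by (rule L_inf_gamma_pos[OF Q R L])
  have symP: "transpose P = P" using L by (simp add: L_inf_def pos_def_def)
  \<comment> \<open>The form at the maximizing \<open>a = \<gamma>\<^sup>-\<^sup>1 Q\<^sup>1\<^sup>/\<^sup>2 x\<close> and \<open>b = \<gamma>\<^sup>-\<^sup>1 R\<^sup>1\<^sup>/\<^sup>2 K x\<close>.\<close>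
  have dissipation: "2 * ((P *v x) \<bullet> (F *v x + Bw *v w)) + g x / \<gamma> \<le> \<gamma> * (w \<bullet> w)" for x w
  proof -
    have "arrow_form Bw \<gamma> (P *v x) (F *v x) (mat_sqrt Q *v x) (mat_sqrt R *v (K *v x)) w
        ((1 / \<gamma>) *\<^sub>R (mat_sqrt Q *v x)) ((1 / \<gamma>) *\<^sub>R (mat_sqrt R *v (K *v x))) \<le> 0"
      using L unfolding L_inf_iff[OF Q R] F_def by blast
    moreover have "2 * (s \<bullet> ((1 / \<gamma>) *\<^sub>R s)) - \<gamma> * (((1 / \<gamma>) *\<^sub>R s) \<bullet> ((1 / \<gamma>) *\<^sub>R s)) = (norm s)\<^sup>2 / \<gamma>"
      for s :: "real ^ 'k"
      using \<gamma> by (simp add: power2_norm_eq_inner)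
    note this[of "mat_sqrt Q *v x"] this[of "mat_sqrt R *v (K *v x)"]
    ultimately show ?thesis
      unfolding arrow_form_def g_def by (simp only: inner_add_right distrib_left add_divide_distrib)
  qed
  have bound: "g x + g y \<le> \<gamma>\<^sup>2 * (p \<bullet> p + q \<bullet> q)"
    if p: "Bw *v p = - \<omega> *\<^sub>R y - F *v x" and q: "Bw *v q = \<omega> *\<^sub>R x - F *v y" for \<omega> x y p q
  proof -
    have "F *v x + Bw *v p = - \<omega> *\<^sub>R y" "F *v y + Bw *v q = \<omega> *\<^sub>R x" using p q by simp_all
    moreover have "(P *v x) \<bullet> y = (P *v y) \<bullet> x"
      using inner_symmetric_matrix[OF symP, of x y] by (simp add: inner_commute)
    ultimately have "g x / \<gamma> + g y / \<gamma> \<le> \<gamma> * (p \<bullet> p) + \<gamma> * (q \<bullet> q)"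
      using dissipation[of x p] dissipation[of y q] by simp
    then show ?thesis using \<gamma> by (simp add: field_simps power2_eq_square)
  qed
  show ?thesis
    unfolding J_inf_le_iff[OF L_inf_imp_stabilizing[OF Q R L]] F_def[symmetric] g_def[symmetric]
  proof (intro conjI allI impI)
    fix \<omega> x y p q
    assume "Bw *v p = - \<omega> *\<^sub>R y - F *v x" "Bw *v q = \<omega> *\<^sub>R x - F *v y"
    then show "g x + g y \<le> \<gamma>\<^sup>2 * (p \<bullet> p + q \<bullet> q)" by (rule bound)
  qed (use \<gamma> in simp)
qed

lemma J_inf_le_imp_L_inf:
  fixes A :: "real ^ 'n ^ 'n" and B :: "real ^ 'm ^ 'n" and Bw Q :: "real ^ 'n ^ 'n" and R :: "real ^ 'm ^ 'm"
  assumes Q: "pos_def Q" and R: "pos_def R" and Bw: "invertible Bw"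
    and K: "K \<in> stabilizing A B" and J: "J_inf A B Bw Q R K \<le> ereal \<gamma>"
  obtains P where "(K, \<gamma>, P) \<in> L_inf A B Bw Q R"
proof -
  define F G where "F = A + B ** K" and "G = output_weight Q R K"
  have "0 \<le> \<gamma>" and freq: "\<And>\<omega> x y p q. Bw *v p = - \<omega> *\<^sub>R y - F *v x \<Longrightarrow> Bw *v q = \<omega> *\<^sub>R x - F *v y \<Longrightarrow>
      x \<bullet> (G *v x) + y \<bullet> (G *v y) \<le> \<gamma>\<^sup>2 * (p \<bullet> p + q \<bullet> q)"
    using J unfolding J_inf_le_iff[OF K] G_def output_weight_form[OF Q R] F_def by blast+
  have G: "pos_def G" unfolding G_def by (rule pos_def_output_weight[OF Q R])
  \<comment> \<open>Otherwise a nonzero constant state \<open>x\<close>, held by a disturbance at frequency \<open>0\<close>, would have zero output.\<close>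
  have "\<gamma> \<noteq> 0"
  proof
    assume "\<gamma> = 0"
    define x :: "real ^ 'n" where "x = axis undefined 1"
    define p where "p = matrix_inv Bw *v (- (F *v x))"
    have "x \<bullet> (G *v x) + 0 \<bullet> (G *v 0) \<le> \<gamma>\<^sup>2 * (p \<bullet> p + (0 :: real ^ 'n) \<bullet> 0)"
    proof (rule freq)
      show "Bw *v p = - 0 *\<^sub>R 0 - F *v x"
        using matrix_inv_mult_right[OF Bw] by (simp add: p_def matrix_vector_mul_assoc)
    qed simp
    then have "x \<bullet> (G *v x) \<le> 0" by (simp add: \<open>\<gamma> = 0\<close>)
    moreover have "x \<noteq> 0" by (simp add: x_def axis_eq_0_iff)
    ultimately show False using G unfolding pos_def_def by (meson not_less)
  qed
  with \<open>0 \<le> \<gamma>\<close> have \<gamma>: "\<gamma> > 0" by simp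
  obtain P where "pos_def P" "\<And>x. riccati_form F Bw G \<gamma> 1 P x \<le> 0"
    using bounded_real_riccati[OF Bw G \<gamma>, of F] K freq unfolding stabilizing_iff F_def by blast
  then show thesis
    using that \<gamma> unfolding L_inf_iff_riccati[OF Q R] F_def G_def by blast
qed

section \<open>Smoothness of matrix inversion\<close>

lemma times_cont_diff_on_cong:
  assumes "open U" "\<And>x. x \<in> U \<Longrightarrow> f x = g x"
  shows "times_cont_diff_on k U f \<longleftrightarrow> times_cont_diff_on k U g"
  using assms(2)
proof (induction k arbitrary: f g)
  case 0
  then show ?case by (simp cong: continuous_on_cong)
next
  case (Suc k)
  have deriv: "(f has_derivative D) (at x) \<longleftrightarrow> (g has_derivative D) (at x)" if "x \<in> U" for x D
    using Suc.prems has_derivative_transform_within_open[OF _ \<open>open U\<close> that] by metis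
  then have "frechet_derivative f (at x) = frechet_derivative g (at x)" if "x \<in> U" for x
    using that by (simp add: frechet_derivative_def)
  then have "times_cont_diff_on k U (\<lambda>x. frechet_derivative f (at x) h) \<longleftrightarrow>
      times_cont_diff_on k U (\<lambda>x. frechet_derivative g (at x) h)" for h
    by (intro Suc.IH) simp
  then show ?case using deriv by (auto simp: differentiable_def)
qed

text \<open>Differentiability classes are computed from a pointwise formula for the derivative.\<close>

lemma times_cont_diff_on_SucI:
  assumes "open U" and f: "\<And>x. x \<in> U \<Longrightarrow> (f has_derivative f' x) (at x)"
    and f': "\<And>h. times_cont_diff_on k U (\<lambda>x. f' x h)"
  shows "times_cont_diff_on (Suc k) U f"
proof -
  have "times_cont_diff_on k U (\<lambda>x. frechet_derivative f (at x) h)" for h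
    using f'[of h] times_cont_diff_on_cong[OF \<open>open U\<close>, of "\<lambda>x. frechet_derivative f (at x) h" "\<lambda>x. f' x h"]
      frechet_derivative_at[OF f] by metis
  then show ?thesis using f by (auto simp: differentiable_def)
qed

lemma times_cont_diff_on_Suc_derivative:
  assumes "times_cont_diff_on (Suc k) U f"
  obtains f' where "\<And>x. x \<in> U \<Longrightarrow> (f has_derivative f' x) (at x)" "\<And>h. times_cont_diff_on k U (\<lambda>x. f' x h)"
  using assms that[of "\<lambda>x. frechet_derivative f (at x)"] by (simp add: frechet_derivative_works)

lemma times_cont_diff_on_SucD: "times_cont_diff_on (Suc k) U f \<Longrightarrow> times_cont_diff_on k U f"
proof (induction k arbitrary: f)
  case 0
  then show ?case
    by (auto intro!: continuous_at_imp_continuous_on differentiable_imp_continuous_within)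
next
  case (Suc k)
  then show ?case unfolding times_cont_diff_on.simps(2)[of "Suc k"] times_cont_diff_on.simps(2)[of k] by metis
qed

lemma times_cont_diff_on_const: "times_cont_diff_on k U (\<lambda>x. c)"
  by (induction k arbitrary: c) simp_all

lemma times_cont_diff_on_bounded_linear:
  assumes "bounded_linear f" shows "times_cont_diff_on k U f"
proof (cases k)
  case 0
  then show ?thesis using assms by (simp add: linear_continuous_on)
next
  case (Suc j)
  have "frechet_derivative f (at x) = f" for x
    using assms bounded_linear_imp_has_derivative frechet_derivative_at by metis
  then show ?thesis
    using assms by (simp add: Suc bounded_linear_imp_differentiable times_cont_diff_on_const)
qed

lemma times_cont_diff_on_add:
  assumes "open U" "times_cont_diff_on k U f" "times_cont_diff_on k U g"
  shows "times_cont_diff_on k U (\<lambda>x. f x + g x)"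
  using assms(2,3)
proof (induction k arbitrary: f g)
  case 0
  then show ?case by (simp add: continuous_on_add)
next
  case (Suc k)
  obtain f' where f': "\<And>x. x \<in> U \<Longrightarrow> (f has_derivative f' x) (at x)" "\<And>h. times_cont_diff_on k U (\<lambda>x. f' x h)"
    using times_cont_diff_on_Suc_derivative[OF Suc.prems(1)] by blast
  obtain g' where g': "\<And>x. x \<in> U \<Longrightarrow> (g has_derivative g' x) (at x)" "\<And>h. times_cont_diff_on k U (\<lambda>x. g' x h)"
    using times_cont_diff_on_Suc_derivative[OF Suc.prems(2)] by blast
  show ?case
    by (rule times_cont_diff_on_SucI[OF \<open>open U\<close>, of _ "\<lambda>x h. f' x h + g' x h"])
      (auto intro!: has_derivative_add f' g' Suc.IH)
qed

lemma times_cont_diff_on_bilinear: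
  assumes "open U" and b: "bounded_bilinear b" and "times_cont_diff_on k U f" "times_cont_diff_on k U g"
  shows "times_cont_diff_on k U (\<lambda>x. b (f x) (g x))"
  using assms(3,4)
proof (induction k arbitrary: f g)
  case 0
  then show ?case by (simp add: bounded_bilinear.continuous_on[OF b])
next
  case (Suc k)
  obtain f' where f': "\<And>x. x \<in> U \<Longrightarrow> (f has_derivative f' x) (at x)" "\<And>h. times_cont_diff_on k U (\<lambda>x. f' x h)"
    using times_cont_diff_on_Suc_derivative[OF Suc.prems(1)] by blast
  obtain g' where g': "\<And>x. x \<in> U \<Longrightarrow> (g has_derivative g' x) (at x)" "\<And>h. times_cont_diff_on k U (\<lambda>x. g' x h)"
    using times_cont_diff_on_Suc_derivative[OF Suc.prems(2)] by blast
  show ?case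
  proof (rule times_cont_diff_on_SucI[OF \<open>open U\<close>])
    show "((\<lambda>x. b (f x) (g x)) has_derivative (\<lambda>h. b (f x) (g' x h) + b (f' x h) (g x))) (at x)" if "x \<in> U" for x
      using f'(1)[OF that] g'(1)[OF that] by (rule bounded_bilinear.FDERIV[OF b])
    show "times_cont_diff_on k U (\<lambda>x. b (f x) (g' x h) + b (f' x h) (g x))" for h
      using times_cont_diff_on_SucD[OF Suc.prems(1)] times_cont_diff_on_SucD[OF Suc.prems(2)]
      by (intro times_cont_diff_on_add[OF \<open>open U\<close>] Suc.IH f' g')
  qed
qed

lemma times_cont_diff_on_bounded_linear_compose:
  assumes "open U" and L: "bounded_linear L" and "times_cont_diff_on k U f"
  shows "times_cont_diff_on k U (\<lambda>x. L (f x))"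
  using assms(3)
proof (induction k arbitrary: f)
  case 0
  then show ?case by (simp add: bounded_linear.continuous_on[OF L])
next
  case (Suc k)
  obtain f' where f': "\<And>x. x \<in> U \<Longrightarrow> (f has_derivative f' x) (at x)" "\<And>h. times_cont_diff_on k U (\<lambda>x. f' x h)"
    using times_cont_diff_on_Suc_derivative[OF Suc.prems(1)] by blast
  show ?case
    by (rule times_cont_diff_on_SucI[OF \<open>open U\<close>, of _ "\<lambda>x h. L (f' x h)"])
      (auto intro!: bounded_linear.has_derivative[OF L] f' Suc.IH)
qed

lemma times_cont_diff_on_Pair:
  assumes U: "open U" and f: "times_cont_diff_on k U f" and g: "times_cont_diff_on k U g"
  shows "times_cont_diff_on k U (\<lambda>x. (f x, g x))"
proof -
  have "times_cont_diff_on k U (\<lambda>x. (f x, 0) + (0, g x))"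
    by (intro times_cont_diff_on_add[OF U]
        times_cont_diff_on_bounded_linear_compose[OF U _ f, of "\<lambda>a. (a, 0)"]
        times_cont_diff_on_bounded_linear_compose[OF U _ g, of "\<lambda>a. (0, a)"]
        bounded_linear_Pair bounded_linear_ident bounded_linear_zero)
  then show ?thesis by simp
qed

lemma continuous_on_det [continuous_intros]:
  fixes f :: "'a::topological_space \<Rightarrow> real ^ 'n ^ 'n"
  assumes "continuous_on U f" shows "continuous_on U (\<lambda>x. det (f x))"
  unfolding det_def by (intro continuous_intros assms)

lemma open_invertible:
  fixes f :: "'a::topological_space \<Rightarrow> real ^ 'n ^ 'n"
  assumes "continuous_on UNIV f" shows "open {x. invertible (f x)}"
  unfolding invertible_det_nz by (intro open_Collect_neq continuous_intros assms)

text \<open>Continuity of the inverse, by Cramer's rule.\<close>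

lemma matrix_inv_cramer:
  fixes M :: "real ^ 'n ^ 'n"
  assumes "invertible M"
  shows "matrix_inv M = (\<chi> i j. det (\<chi> k l. if l = i then axis j 1 $ k else M $ k $ l) / det M)"
proof -
  have "matrix_inv M $ i $ j = det (\<chi> k l. if l = i then axis j 1 $ k else M $ k $ l) / det M" for i j
  proof -
    have "M *v (matrix_inv M *v axis j 1) = axis j 1"
      by (simp add: matrix_vector_mul_assoc matrix_inv_mult_right[OF assms])
    then have "matrix_inv M *v axis j 1 = (\<chi> i. det (\<chi> k l. if l = i then axis j 1 $ k else M $ k $ l) / det M)"
      using cramer[of M] assms by (simp add: invertible_det_nz)
    moreover have "(matrix_inv M *v axis j 1) $ i = matrix_inv M $ i $ j"
      by (simp add: matrix_vector_mult_basis column_def)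
    ultimately show ?thesis by simp
  qed
  then show ?thesis by (simp add: vec_eq_iff)
qed

lemma continuous_on_matrix_inv:
  fixes f :: "'a::topological_space \<Rightarrow> real ^ 'n ^ 'n"
  assumes f: "continuous_on U f" and inv: "\<And>x. x \<in> U \<Longrightarrow> invertible (f x)"
  shows "continuous_on U (\<lambda>x. matrix_inv (f x))"
proof -
  have if_cont: "continuous_on U (\<lambda>x. if l = i then c else f x $ k $ l)" for i k l and c :: real
    by (cases "l = i") (auto intro!: continuous_intros f)
  have "continuous_on U (\<lambda>x. \<chi> i j. det (\<chi> k l. if l = i then axis j 1 $ k else f x $ k $ l) / det (f x))"
    using inv by (intro continuous_intros if_cont f) (auto simp: invertible_det_nz)
  then show ?thesis
    by (rule continuous_on_eq) (simp add: matrix_inv_cramer inv)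
qed

lemma has_derivative_matrix_inv:
  fixes M :: "real ^ 'n ^ 'n"
  assumes M: "invertible M"
  shows "(matrix_inv has_derivative (\<lambda>H. - (matrix_inv M ** H ** matrix_inv M))) (at M)"
proof -
  define N where "N = matrix_inv M"
  have lin: "bounded_linear (\<lambda>H. - (N ** H ** N))"
    unfolding linear_conv_bounded_linear[symmetric]
    by (rule linearI) (simp_all add: matrix_mult_bilinear_simps)
  have U: "open {X :: real ^ 'n ^ 'n. invertible X}"
    by (rule open_invertible[OF continuous_on_id])
  have "continuous_on {X :: real ^ 'n ^ 'n. invertible X} matrix_inv"
    by (rule continuous_on_matrix_inv[OF continuous_on_id]) simp
  then have "isCont matrix_inv M"
    using M unfolding continuous_on_eq_continuous_at[OF U] by simp
  obtain k where k: "k > 0" "\<And>(A :: real ^ 'n ^ 'n) (B :: real ^ 'n ^ 'n). norm (A ** B) \<le> norm A * norm B * k"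
    using bounded_bilinear.pos_bounded[OF bounded_bilinear_matrix_mult] by blast
  show ?thesis
    unfolding N_def[symmetric] has_derivative_iff_norm
  proof (intro conjI lin)
    have "((\<lambda>X. norm (N - matrix_inv X) * k * norm N * k) \<longlongrightarrow> norm (N - matrix_inv M) * k * norm N * k) (at M)"
      using \<open>isCont matrix_inv M\<close> by (intro tendsto_intros) (simp add: isCont_def)
    then have lim: "((\<lambda>X. norm (N - matrix_inv X) * k * norm N * k) \<longlongrightarrow> 0) (at M)"
      by (simp add: N_def)
    have upper: "\<forall>\<^sub>F X in at M. norm (matrix_inv X - N - - (N ** (X - M) ** N)) / norm (X - M)
        \<le> norm (N - matrix_inv X) * k * norm N * k"
    proof -
      have "\<forall>\<^sub>F X in at M. invertible X"
        using U M by (auto simp: eventually_at_topological)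
      moreover have "\<forall>\<^sub>F X in at M. X \<noteq> M" by (simp add: eventually_at_filter)
      ultimately show ?thesis
      proof eventually_elim
        case (elim X)
        \<comment> \<open>The resolvent identity \<open>X\<^sup>-\<^sup>1 - M\<^sup>-\<^sup>1 = - X\<^sup>-\<^sup>1 (X - M) M\<^sup>-\<^sup>1\<close>.\<close>
        have "matrix_inv X ** (X - M) ** N = N - matrix_inv X"
          using matrix_inv_mult_left[OF elim(1)] matrix_inv_mult_right[OF M]
          by (simp add: matrix_mult_bilinear_simps N_def matrix_mul_assoc[symmetric])
        moreover have "(N - matrix_inv X) ** (X - M) ** N = N ** (X - M) ** N - matrix_inv X ** (X - M) ** N"
          by (simp only: bounded_bilinear.diff_left[OF bounded_bilinear_matrix_mult])
        ultimately have "matrix_inv X - N - - (N ** (X - M) ** N) = (N - matrix_inv X) ** (X - M) ** N"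
          by (simp add: N_def)
        also have "norm \<dots> \<le> norm ((N - matrix_inv X) ** (X - M)) * norm N * k" by (rule k(2))
        also have "\<dots> \<le> (norm (N - matrix_inv X) * norm (X - M) * k) * norm N * k"
          using k(1) by (intro mult_right_mono k(2)) auto
        finally show ?case using elim(2) by (simp add: field_simps)
      qed
    qed
    show "((\<lambda>X. norm (matrix_inv X - N - - (N ** (X - M) ** N)) / norm (X - M)) \<longlongrightarrow> 0) (at M)"
      by (rule tendsto_sandwich[OF _ upper tendsto_const lim]) simp
  qed
qed

lemma times_cont_diff_on_matrix_inv:
  fixes L :: "'a::euclidean_space \<Rightarrow> real ^ 'n ^ 'n"
  assumes L: "bounded_linear L"
  shows "times_cont_diff_on k {x. invertible (L x)} (\<lambda>x. matrix_inv (L x))"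
proof -
  let ?U = "{x. invertible (L x)}"
  have U: "open ?U" by (intro open_invertible linear_continuous_on L)
  show ?thesis
  proof (induction k)
    case 0
    show ?case
      unfolding times_cont_diff_on.simps(1)
      by (rule continuous_on_matrix_inv) (auto intro: linear_continuous_on L)
  next
    case (Suc k)
    show ?case
    proof (rule times_cont_diff_on_SucI[OF U])
      show "((\<lambda>x. matrix_inv (L x)) has_derivative (\<lambda>h. - (matrix_inv (L x) ** L h ** matrix_inv (L x)))) (at x)"
        if "x \<in> ?U" for x
        using has_derivative_compose[OF bounded_linear_imp_has_derivative[OF L], of matrix_inv _ x UNIV]
          has_derivative_matrix_inv[of "L x"] that by simp
      show "times_cont_diff_on k ?U (\<lambda>x. - (matrix_inv (L x) ** L h ** matrix_inv (L x)))" for h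
        by (intro times_cont_diff_on_bounded_linear_compose[OF U bounded_linear_minus[OF bounded_linear_ident]]
            times_cont_diff_on_bilinear[OF U bounded_bilinear_matrix_mult] Suc.IH times_cont_diff_on_const)
    qed
  qed
qed

section \<open>The change of variables\<close>

lemma F_inf_convex:
  fixes A :: "real ^ 'n ^ 'n" and B :: "real ^ 'm ^ 'n" and Bw Q :: "real ^ 'n ^ 'n" and R :: "real ^ 'm ^ 'm"
  assumes Q: "pos_def Q" and R: "pos_def R"
  shows "convex (F_inf A B Bw Q R)"
  unfolding convex_def
proof safe
  define f where "f \<gamma> Y X x w a b = arrow_form Bw \<gamma> x ((A ** X + B ** Y) *v x) (mat_sqrt Q *v (X *v x))
    (mat_sqrt R *v (Y *v x)) w a b" for \<gamma> Y X x w a b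
  fix \<gamma> \<gamma>' and Y Y' :: "real ^ 'n ^ 'm" and X X' :: "real ^ 'n ^ 'n" and u v :: real
  assume 1: "(\<gamma>, Y, X) \<in> F_inf A B Bw Q R" and 2: "(\<gamma>', Y', X') \<in> F_inf A B Bw Q R"
    and uv: "0 \<le> u" "0 \<le> v" "u + v = 1"
  have "pos_def (u *\<^sub>R X + v *\<^sub>R X')"
    using pos_def_convex 1 2 uv unfolding F_inf_iff[OF Q R] convex_def by blast
  moreover have "f (u * \<gamma> + v * \<gamma>') (u *\<^sub>R Y + v *\<^sub>R Y') (u *\<^sub>R X + v *\<^sub>R X') x w a b \<le> 0" for x w a b
  proof -
    \<comment> \<open>The form is affine: the term \<open>2 x\<^sup>T B\<^sub>w w\<close>, free of the variables, is split according to \<open>u + v = 1\<close>.\<close>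
    have w: "x \<bullet> (Bw *v w) = u * (x \<bullet> (Bw *v w)) + v * (x \<bullet> (Bw *v w))"
      using uv by (simp flip: distrib_right)
    have "f (u * \<gamma> + v * \<gamma>') (u *\<^sub>R Y + v *\<^sub>R Y') (u *\<^sub>R X + v *\<^sub>R X') x w a b =
        u * f \<gamma> Y X x w a b + v * f \<gamma>' Y' X' x w a b"
      unfolding f_def arrow_form_def
      by (subst w)
        (simp add: matrix_vector_left_simps matrix_vector_right_distrib matrix_vector_mult_scaleR
          matrix_vector_mul_assoc[symmetric] inner_add algebra_simps)
    also have "\<dots> \<le> 0"
      using 1 2 uv unfolding F_inf_iff[OF Q R] f_def[symmetric]
      by (intro add_nonpos_nonpos mult_nonneg_nonpos) auto
    finally show ?thesis .
  qed
  ultimately show "u *\<^sub>R (\<gamma>, Y, X) + v *\<^sub>R (\<gamma>', Y', X') \<in> F_inf A B Bw Q R"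
    unfolding f_def by (simp add: F_inf_iff[OF Q R])
qed

text \<open>The inverse \<open>(\<gamma>, Y, X) \<mapsto> (Y X\<^sup>-\<^sup>1, \<gamma>, X\<^sup>-\<^sup>1)\<close> of \<open>\<Phi>\<^sub>\<infinity>\<close>.\<close>

definition Phi_inf_inv :: "real \<times> (real ^ 'n ^ 'm) \<times> (real ^ 'n ^ 'n) \<Rightarrow> (real ^ 'n ^ 'm) \<times> real \<times> (real ^ 'n ^ 'n)"
  where "Phi_inf_inv = (\<lambda>(\<gamma>, Y, X). (Y ** matrix_inv X, \<gamma>, matrix_inv X))"

lemma Phi_inf_inv_Phi_inf: "invertible P \<Longrightarrow> Phi_inf_inv (Phi_inf (K, \<gamma>, P)) = (K, \<gamma>, P)"
  by (simp add: Phi_inf_def Phi_inf_inv_def matrix_inv_matrix_inv matrix_mul_assoc[symmetric] matrix_inv_mult_left)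

lemma Phi_inf_Phi_inf_inv: "invertible X \<Longrightarrow> Phi_inf (Phi_inf_inv (\<gamma>, Y, X)) = (\<gamma>, Y, X)"
  by (simp add: Phi_inf_def Phi_inf_inv_def matrix_inv_matrix_inv matrix_mul_assoc[symmetric] matrix_inv_mult_left)

text \<open>The congruence with \<open>diag(P\<^sup>-\<^sup>1, I, I, I)\<close> turns one matrix inequality into the other.\<close>

lemma L_inf_iff_F_inf:
  fixes A :: "real ^ 'n ^ 'n" and B :: "real ^ 'm ^ 'n" and Bw Q :: "real ^ 'n ^ 'n" and R :: "real ^ 'm ^ 'm"
  assumes Q: "pos_def Q" and R: "pos_def R" and P: "invertible P"
  shows "(K, \<gamma>, P) \<in> L_inf A B Bw Q R \<longleftrightarrow> Phi_inf (K, \<gamma>, P) \<in> F_inf A B Bw Q R"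
proof -
  define X where "X = matrix_inv P"
  define f where "f x = (\<forall>w a b. arrow_form Bw \<gamma> (P *v x) ((A + B ** K) *v x) (mat_sqrt Q *v x)
    (mat_sqrt R *v (K *v x)) w a b \<le> 0)" for x
  have PX: "P *v (X *v x) = x" and XP: "X *v (P *v x) = x" for x
    using P by (simp_all add: X_def matrix_vector_mul_assoc matrix_inv_mult_left matrix_inv_mult_right)
  have AX: "(A ** X + B ** (K ** X)) *v x = (A + B ** K) *v (X *v x)" for x
    by (simp add: matrix_vector_left_simps matrix_vector_mul_assoc[symmetric])
  have "pos_def X \<longleftrightarrow> pos_def P"
    using pos_def_matrix_inv[of P] pos_def_matrix_inv[of X] P by (auto simp: X_def matrix_inv_matrix_inv)
  moreover have "(\<forall>x. f x) \<longleftrightarrow> (\<forall>x. f (X *v x))"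
    by (metis XP)
  ultimately show ?thesis
    unfolding Phi_inf_def case_prod_conv L_inf_iff[OF Q R] F_inf_iff[OF Q R] X_def[symmetric] AX
      matrix_vector_mul_assoc[symmetric, of K X] f_def[symmetric]
    unfolding f_def PX by simp
qed

lemma Phi_inf_bij_betw:
  fixes A :: "real ^ 'n ^ 'n" and B :: "real ^ 'm ^ 'n" and Bw Q :: "real ^ 'n ^ 'n" and R :: "real ^ 'm ^ 'm"
  assumes Q: "pos_def Q" and R: "pos_def R"
  shows "bij_betw Phi_inf (L_inf A B Bw Q R) (F_inf A B Bw Q R)"
proof (rule bij_betw_byWitness[where f' = Phi_inf_inv])
  have L: "invertible P" if "(K, \<gamma>, P) \<in> L_inf A B Bw Q R" for K \<gamma> P
    using that by (simp add: L_inf_def pos_def_imp_invertible)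
  have F: "invertible X" if "(\<gamma>, Y, X) \<in> F_inf A B Bw Q R" for \<gamma> Y X
    using that by (simp add: F_inf_def pos_def_imp_invertible)
  show "\<forall>z\<in>L_inf A B Bw Q R. Phi_inf_inv (Phi_inf z) = z"
    by (auto intro: Phi_inf_inv_Phi_inf L)
  show "\<forall>z\<in>F_inf A B Bw Q R. Phi_inf (Phi_inf_inv z) = z"
    by (auto intro: Phi_inf_Phi_inf_inv F)
  show "Phi_inf ` L_inf A B Bw Q R \<subseteq> F_inf A B Bw Q R"
  proof (rule image_subsetI)
    fix z assume z: "z \<in> L_inf A B Bw Q R"
    obtain K \<gamma> P where "z = (K, \<gamma>, P)" by (metis prod_cases3)
    then show "Phi_inf z \<in> F_inf A B Bw Q R"
      using z L L_inf_iff_F_inf[OF Q R] by metis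
  qed
  show "Phi_inf_inv ` F_inf A B Bw Q R \<subseteq> L_inf A B Bw Q R"
  proof (rule image_subsetI)
    fix z assume z: "z \<in> F_inf A B Bw Q R"
    obtain \<gamma> Y X where \<gamma>YX: "z = (\<gamma>, Y, X)" by (metis prod_cases3)
    obtain K \<gamma>' P where KP: "Phi_inf_inv z = (K, \<gamma>', P)" by (metis prod_cases3)
    have X: "invertible X" using F z \<gamma>YX by blast
    then have "invertible P" using KP by (auto simp: \<gamma>YX Phi_inf_inv_def matrix_inv_invertible)
    moreover have "Phi_inf (K, \<gamma>', P) = z"
      using Phi_inf_Phi_inf_inv[OF X] by (simp add: KP[symmetric] \<gamma>YX)
    ultimately show "Phi_inf_inv z \<in> L_inf A B Bw Q R"
      using L_inf_iff_F_inf[OF Q R, of P K \<gamma>'] z by (simp add: KP)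
  qed
qed

text \<open>The extension is \<open>\<Phi>\<^sub>\<infinity>\<close> itself, on the open set of all triples with invertible (not necessarily symmetric) last
  component.\<close>

lemma Phi_inf_C_diffeomorphism:
  fixes A :: "real ^ 'n ^ 'n" and B :: "real ^ 'm ^ 'n" and Bw Q :: "real ^ 'n ^ 'n" and R :: "real ^ 'm ^ 'm"
  assumes Q: "pos_def Q" and R: "pos_def R"
  shows "C_diffeomorphism k (L_inf A B Bw Q R) (F_inf A B Bw Q R) Phi_inf"
proof -
  define U where "U = {z :: (real ^ 'n ^ 'm) \<times> real \<times> (real ^ 'n ^ 'n). invertible (snd (snd z))}"
  define V where "V = {z :: real \<times> (real ^ 'n ^ 'm) \<times> (real ^ 'n ^ 'n). invertible (snd (snd z))}"
  let ?\<Phi> = "Phi_inf :: (real ^ 'n ^ 'm) \<times> real \<times> (real ^ 'n ^ 'n) \<Rightarrow> _"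
  have snd2: "bounded_linear (\<lambda>z. snd (snd z))"
    by (intro bounded_linear_intros)
  have U: "open U" and V: "open V"
    unfolding U_def V_def by (intro open_invertible continuous_intros)+
  have inv: "?\<Phi> z \<in> V" "Phi_inf_inv (?\<Phi> z) = z" if "z \<in> U" for z
    using that Phi_inf_inv_Phi_inf[of "snd (snd z)" "fst z" "fst (snd z)"]
    by (auto simp: U_def V_def Phi_inf_def matrix_inv_invertible split: prod.splits)
  have inv': "Phi_inf_inv z \<in> U" "?\<Phi> (Phi_inf_inv z) = z" if "z \<in> V" for z
    using that Phi_inf_Phi_inf_inv[of "snd (snd z)" "fst z" "fst (snd z)"]
    by (auto simp: U_def V_def Phi_inf_inv_def matrix_inv_invertible split: prod.splits)
  have inj: "inj_on ?\<Phi> U" using inv(2) by (metis inj_onI)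
  have image: "?\<Phi> ` U = V" using inv(1) inv' by (metis image_subset_iff rev_image_eqI subsetI subset_antisym)
  have smooth: "times_cont_diff_on j U ?\<Phi>" for j
  proof -
    have "times_cont_diff_on j U (\<lambda>z. (fst (snd z), fst z ** matrix_inv (snd (snd z)), matrix_inv (snd (snd z))))"
      unfolding U_def
      by (intro times_cont_diff_on_Pair[OF U[unfolded U_def]] times_cont_diff_on_matrix_inv[OF snd2]
          times_cont_diff_on_bilinear[OF U[unfolded U_def] bounded_bilinear_matrix_mult]
          times_cont_diff_on_bounded_linear bounded_linear_intros)
    then show ?thesis by (simp add: Phi_inf_def case_prod_unfold)
  qed
  have "times_cont_diff_on j V Phi_inf_inv" for j
  proof -
    have "times_cont_diff_on j V (\<lambda>z. (fst (snd z) ** matrix_inv (snd (snd z)), fst z, matrix_inv (snd (snd z))))"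
      unfolding V_def
      by (intro times_cont_diff_on_Pair[OF V[unfolded V_def]] times_cont_diff_on_matrix_inv[OF snd2]
          times_cont_diff_on_bilinear[OF V[unfolded V_def] bounded_bilinear_matrix_mult]
          times_cont_diff_on_bounded_linear bounded_linear_intros)
    then show ?thesis by (simp add: Phi_inf_inv_def case_prod_unfold)
  qed
  moreover have "the_inv_into U ?\<Phi> z = Phi_inf_inv z" if "z \<in> V" for z
    using inv'[OF that] by (intro the_inv_into_f_eq[OF inj])
  ultimately have smooth_inv: "times_cont_diff_on j V (the_inv_into U ?\<Phi>)" for j
    using times_cont_diff_on_cong[OF V] by blast
  have "L_inf A B Bw Q R \<subseteq> U"
    by (auto simp: U_def L_inf_def pos_def_imp_invertible)
  then show ?thesis
    unfolding C_diffeomorphism_def C_on_def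
    using Phi_inf_bij_betw[OF Q R] U V inj smooth smooth_inv image
    by (intro conjI exI[of _ U] exI[of _ ?\<Phi>]) auto
qed

theorem proposition4p2:
  fixes A :: "real ^ 'n ^ 'n" and B :: "real ^ 'm ^ 'n" and Bw :: "real ^ 'n ^ 'n"
    and Q :: "real ^ 'n ^ 'n" and R :: "real ^ 'm ^ 'm"
  assumes "controllable A B"
    and "observable (mat_sqrt Q) A"
    and "rank Bw = CARD('n)"
    and "pos_def Q"
    and "pos_def R"
  shows "(\<forall>K \<gamma>. K \<in> stabilizing A B \<and> J_inf A B Bw Q R K \<le> ereal \<gamma> \<longleftrightarrow>
            (\<exists>P. (K, \<gamma>, P) \<in> L_inf A B Bw Q R))
       \<and> proj_K_gamma (L_inf A B Bw Q R) = epi_J_inf A B Bw Q R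
       \<and> convex (F_inf A B Bw Q R)
       \<and> C_diffeomorphism 2 (L_inf A B Bw Q R) (F_inf A B Bw Q R) Phi_inf
       \<and> C_diffeomorphism \<infinity> (L_inf A B Bw Q R) (F_inf A B Bw Q R) Phi_inf"
proof -
  note QR = \<open>pos_def Q\<close> \<open>pos_def R\<close>
  have "inj ((*v) Bw)"
    using \<open>rank Bw = CARD('n)\<close> by (simp add: full_rank_injective)
  then have "invertible Bw"
    by (simp add: invertible_left_inverse matrix_left_invertible_injective)
  then have epi: "K \<in> stabilizing A B \<and> J_inf A B Bw Q R K \<le> ereal \<gamma> \<longleftrightarrow>
      (\<exists>P. (K, \<gamma>, P) \<in> L_inf A B Bw Q R)" for K \<gamma>
    using L_inf_imp_stabilizing[OF QR] L_inf_imp_J_inf_le[OF QR] J_inf_le_imp_L_inf[OF QR] by metis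
  then have "proj_K_gamma (L_inf A B Bw Q R) = epi_J_inf A B Bw Q R"
    unfolding proj_K_gamma_def epi_J_inf_def by simp
  with epi show ?thesis
    by (simp add: F_inf_convex[OF QR] Phi_inf_C_diffeomorphism[OF QR])
qed

end
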